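(* Let $W$ be a scattered $\omega$-Stone space. Then $W$ is primitive, and $\{W^{[\xi]}\mid\xi<\nu(W)\}$ is a complete trim $(P_W,L_W,f_W)$-partition of $W$.
   Context: An $\omega$-Stone space is a locally compact metrisable totally disconnected Hausdorff space. $W^{(0)}=W$, $W^{(\xi+1)}$ = derived set of $W^{(\xi)}$, intersections at limits; $W^{[\xi]}=W^{(\xi)}-W^{(\xi+1)}$; $\nu(W)=\min\{\xi\mid W^{(\xi)}=W^{(\xi+1)}\}$; $K(W)=W^{(\nu(W))}$; $W$ is scattered if $K(W)=\emptyset$; $n(W)=|W^{(\mu)}-K(W)|$ if $\nu(W)=\mu+1$ and this is finite, else $-\infty$; $\rho(W)=\min\{\xi\mid\overline{W^{[\xi]}}\text{ compact}\}$. Primitivity: for a Boolean ring $R$ and $A\in R$ let $(A)=\{C\in R\mid C\subseteq A\}$. $A$ is pseudo-indecomposable (PI) if for all $B\in R$ with $B\subseteq A$, $(B)\cong(A)$ or $(A-B)\cong(A)$ as Boolean rings. $R$, and its Stone space, are primitive if every element of $R$ is a disjoint union of finitely many PI elements; for $W$ take $R$ the ring of compact open subsets of $W$. PO systems: a PO system is a set $P$ with an antisymmetric transitive relation $<$; $p\leqslant q$ means $p<q$ or $p=q$; $P^d=\{p\mid p\not<p\}$; $P_{\min}$ is the set of $\leqslant$-minimal elements; $Q$ is a lower subset if $q\in Q$, $r\leqslant q$ imply $r\in Q$. $L^d_{\min}=L_{\min}\cap P^d$. Partitions: a family $\{X_p\mid p\in P\}$ of nonempty pairwise disjoint subsets of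 $W$ with union $X$ is a $P$-partition of $W$ if $X_p'\cap X=\bigcup_{q<p}X_q$ for all $p$; it is complete if $X=W$. For $Y\subseteq W$, $T(Y)=\{p\mid Y\cap X_p\neq\emptyset\}$. A compact open $A$ is $p$-trim if $T(A)=\{q\mid q\geqslant p\}$ and, when $p\in P^d$, $|A\cap X_p|=1$. A $P$-partition is trim if: (T1) every point of $W$ has a neighbourhood base of trim sets; (T2) for each $p$, every point with a neighbourhood base of $p$-trim sets lies in $X_p$; (T3) every point of $X_p$ has a $p$-trim neighbourhood. For a lower subset $L$ of $P$ and $f\colon L^d_{\min}\to\mathbb{N}_+$, a trim $(P,L,f)$-partition is a trim $P$-partition with $\overline{X_p}$ compact iff $p\in L$, and $|X_p|=f(p)$ for $p\in L^d_{\min}$. For an ordinal $\nu$, $N(\nu)$ is the PO system on $\{\xi\mid\xi<\nu\}$ with $p\prec q$ iff $p>q$ as ordinals (so $N(\nu)^d=N(\nu)$). For scattered $W$: $P_W=N(\nu(W))$ (the set $W^{[\xi]}$ indexed by $\xi\in P_W$); $L_W=\{\xi\in P_W\mid \xi\geqslant\rho(W)\text{ as ordinals}\}$; $f_W$ is the empty function if $\rho(W)=\nu(W)$, and otherwise ($\nu(W)=\mu+1$) $f_W(\mu)=n(W)$. *)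

theory Defs
  imports "HOL-Analysis.Analysis" "HOL-Algebra.QuotRing"
begin

section \<open>Ordinals\<close>

text \<open>
  Order types of well-orders on subsets of \<^typ>\<open>'a + nat\<close>, that is, the ordinals of cardinality
  at most \<open>max |'a| \<aleph>\<^sub>0\<close>. They have no greatest element and there are more of them than there are
  elements of \<^typ>\<open>'a\<close> (\<open>no_inj_ordinal\<close> below). Hence a decreasing transfinite sequence of
  subsets of \<^typ>\<open>'a\<close> is stationary from some such ordinal on, and minima taken over these
  ordinals agree with minima over all ordinals.
\<close>

quotient_type 'a ordinal = "('a + nat) rel" / partial: "\<lambda>r s. (r, s) \<in> ordIso"
proof (rule part_equivpI)
  show "\<exists>r :: ('a + nat) rel. (r, r) \<in> ordIso"
    using ordIso_reflexive[OF card_of_Well_order] by blast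
  show "symp (\<lambda>r s :: ('a + nat) rel. (r, s) \<in> ordIso)"
    by (auto intro: sympI ordIso_symmetric)
  show "transp (\<lambda>r s :: ('a + nat) rel. (r, s) \<in> ordIso)"
    by (auto intro: transpI ordIso_transitive)
qed

no_notation eq_closure_of (\<open>closure'_of\<index>\<close>)

instantiation ordinal :: (type) wellorder
begin

lift_definition less_eq_ordinal :: "'a ordinal \<Rightarrow> 'a ordinal \<Rightarrow> bool" is "\<lambda>r s. (r, s) \<in> ordLeq"
  by (meson ordIso_iff_ordLeq ordLeq_transitive)

lift_definition less_ordinal :: "'a ordinal \<Rightarrow> 'a ordinal \<Rightarrow> bool" is "\<lambda>r s. (r, s) \<in> ordLess"
  by (meson ordIso_ordLess_trans ordIso_symmetric ordLess_ordIso_trans)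

instance
proof
  have wo: "Well_order r \<and> Well_order s" if "(r, s) \<in> ordIso" for r s :: "('a + nat) rel"
    using that by (auto simp: ordIso_def)
  fix x y z :: "'a ordinal"
  show "x < y \<longleftrightarrow> x \<le> y \<and> \<not> y \<le> x"
    by transfer (meson wo not_ordLess_ordLeq ordLess_imp_ordLeq ordLess_or_ordLeq)
  show "x \<le> x"
    by transfer (meson ordIso_iff_ordLeq)
  show "x \<le> y \<Longrightarrow> y \<le> z \<Longrightarrow> x \<le> z"
    by transfer (meson ordLeq_transitive)
  show "x \<le> y \<Longrightarrow> y \<le> x \<Longrightarrow> x = y"
    by transfer (meson ordIso_iff_ordLeq)
  show "x \<le> y \<or> y \<le> x"
    by transfer (meson wo ordLess_imp_ordLeq ordLess_or_ordLeq)
next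
  fix P :: "'a ordinal \<Rightarrow> bool" and a
  assume step: "\<And>x. (\<And>y. y < x \<Longrightarrow> P y) \<Longrightarrow> P x"
  have iff: "(rep_ordinal x, rep_ordinal y) \<in> ordLess \<longleftrightarrow> x < y" for x y :: "'a ordinal"
    by (simp add: less_ordinal_def)
  have "wf {(x, y :: 'a ordinal). x < y}"
    using wf_inv_image[OF wf_ordLess, of "rep_ordinal :: 'a ordinal \<Rightarrow> _"] unfolding inv_image_def iff .
  then show "P a"
    using step by (induction a rule: wf_induct_rule) auto
qed

end

lemma Well_order_empty: "Well_order {}"
  by (simp add: well_order_on_def linear_order_on_def partial_order_on_def
      preorder_on_def refl_on_def trans_def antisym_def total_on_def)

instantiation ordinal :: (type) zero
begin

lift_definition zero_ordinal :: "'a ordinal" is "{}"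
  by (rule ordIso_reflexive[OF Well_order_empty])

instance ..

end

lemma ordinal_zero_le [simp]: "0 \<le> (\<xi> :: 'a ordinal)"
proof transfer
  fix r :: "('a + nat) rel" assume "(r, r) \<in> ordIso"
  then have "Well_order r" by (auto simp: ordIso_def)
  then show "({}, r) \<in> ordLeq"
    using Well_order_empty by (auto simp: ordLeq_def embed_def)
qed

lemma less_ordinal_iff: "x < y \<longleftrightarrow> (rep_ordinal x, rep_ordinal y) \<in> ordLess"
  by (simp add: less_ordinal_def)

lemma Well_order_rep_ordinal: "Well_order (rep_ordinal x)"
proof -
  have "(rep_ordinal x, rep_ordinal x) \<in> ordIso"
    using Quotient3_rep_reflp[OF Quotient3_ordinal] .
  then show ?thesis by (auto simp: ordIso_def)
qed

lemma rep_ordinal_eqI: "(rep_ordinal x, rep_ordinal y) \<in> ordIso \<Longrightarrow> x = y"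
  using Quotient3_rel_rep[OF Quotient3_ordinal] by (rule iffD1)

lemma rep_abs_ordinal: "Well_order r \<Longrightarrow> (rep_ordinal (abs_ordinal r), r) \<in> ordIso"
  by (rule rep_abs_rsp_left[OF Quotient3_ordinal]) (rule ordIso_reflexive)

lemma inj_on_ordinals_below: "\<exists>h :: 'a ordinal \<Rightarrow> 'a + nat. inj_on h {..<\<xi>}"
proof -
  let ?r = "rep_ordinal \<xi>"
  have "\<exists>a. (rep_ordinal \<eta>, Restr ?r (underS ?r a)) \<in> ordIso" if "\<eta> < \<xi>" for \<eta>
    using that ordLess_iff_ordIso_Restr[OF Well_order_rep_ordinal Well_order_rep_ordinal]
    unfolding less_ordinal_iff by blast
  then obtain h where "\<And>\<eta>. \<eta> < \<xi> \<Longrightarrow> (rep_ordinal \<eta>, Restr ?r (underS ?r (h \<eta>))) \<in> ordIso"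
    by metis
  then have "inj_on h {..<\<xi>}"
    by (intro inj_onI rep_ordinal_eqI) (metis lessThan_iff ordIso_symmetric ordIso_transitive)
  then show ?thesis by blast
qed

lemma no_inj_ordinal_sum: "\<not> inj (g :: 'a ordinal \<Rightarrow> 'a + nat)"
proof
  assume g: "inj g"
  let ?le = "{(x, y :: 'a ordinal). x \<le> y}"
  define r where "r = dir_image ?le g"
  have "wf {(x, y :: 'a ordinal). x < y}" by (rule wf)
  moreover have "?le - Id = {(x, y :: 'a ordinal). x < y}" by auto
  ultimately have wf: "wf (?le - Id)" by simp
  have "Linear_order ?le"
    by (auto simp: linear_order_on_def partial_order_on_def preorder_on_def
        refl_on_def trans_def antisym_def total_on_def Field_def)
  with wf have le: "Well_order ?le" by (simp add: well_order_on_def)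
  have r: "Well_order r"
    unfolding r_def using le g by (intro Well_order_dir_image) (auto intro: inj_on_subset)
  define f where "f x = (abs_ordinal (Restr r (underS r (g x))) :: 'a ordinal)" for x
  have rf: "(rep_ordinal (f x), Restr r (underS r (g x))) \<in> ordIso" for x
    unfolding f_def by (intro rep_abs_ordinal Well_order_Restr r)
  have r_iff: "(a, b) \<in> r \<longleftrightarrow> (\<exists>x y. a = g x \<and> b = g y \<and> x \<le> y)" for a b
    by (auto simp: r_def dir_image_def)
  have gF: "g x \<in> Field r" for x
    by (rule FieldI1[of _ "g x"]) (auto simp: r_iff)
  have under: "underS r (g x) = g ` {..<x}" for x
    using g by (auto simp: underS_def r_iff inj_eq less_le)
  have mono: "f x < f y" if "x < y" for x y
  proof -
    let ?s = "Restr r (underS r (g y))"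
    have "g x \<in> underS r (g y)" using that by (auto simp: under)
    moreover have "Well_order ?s" by (rule Well_order_Restr[OF r])
    moreover have "(g x, g x) \<in> ?s"
      using that by (auto simp: under r_iff)
    then have "Field ?s \<noteq> {}" by (auto intro: FieldI1)
    ultimately have "(Restr ?s (underS ?s (g x)), ?s) \<in> ordLess"
      using underS_Restr_ordLess[of ?s "g x"] by auto
    moreover have "Restr ?s (underS ?s (g x)) = Restr r (underS r (g x))"
      using that g by (auto simp: underS_def r_iff inj_eq) 
    ultimately show ?thesis
      unfolding less_ordinal_iff
      by (metis rf[of x] rf[of y] ordIso_ordLess_trans ordLess_ordIso_trans ordIso_symmetric)
  qed
  have ge: "x \<le> f x" for x
  proof (induction x rule: less_induct)
    case (less x)
    show ?case
    proof (rule ccontr)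
      assume "\<not> x \<le> f x"
      then have "f x < x" by simp
      then show False using less mono by (meson leD)
    qed
  qed
  have "f x < abs_ordinal r" for x
  proof -
    have "(Restr r (underS r (g x)), r) \<in> ordLess"
      using underS_Restr_ordLess[OF r] gF by blast
    then show ?thesis
      unfolding less_ordinal_iff
      by (metis rf[of x] rep_abs_ordinal[OF r] ordIso_ordLess_trans ordLess_ordIso_trans
          ordIso_symmetric)
  qed
  then show False using ge leD by blast
qed

lemma no_inj_ordinal: "\<not> inj (g :: 'a ordinal \<Rightarrow> 'a)"
proof
  assume "inj g"
  then have "inj (\<lambda>x. Inl (g x) :: 'a + nat)" by (auto simp: inj_def)
  then show False using no_inj_ordinal_sum by blast
qed

lemma ordinal_gt_ex: "\<exists>\<eta>. (\<xi> :: 'a ordinal) < \<eta>"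
proof (rule ccontr)
  assume "\<not> ?thesis"
  then have top: "\<eta> = \<xi> \<or> \<eta> < \<xi>" for \<eta> by (meson neqE)
  obtain h :: "'a ordinal \<Rightarrow> 'a + nat" where h: "inj_on h {..<\<xi>}"
    using inj_on_ordinals_below by blast
  define s :: "'a + nat \<Rightarrow> 'a + nat" where "s = map_sum id Suc"
  have "inj s" unfolding s_def by (intro sum.inj_map) auto
  moreover have "s z \<noteq> Inr 0" for z by (cases z) (auto simp: s_def)
  ultimately have "inj (\<lambda>\<eta>. if \<eta> = \<xi> then Inr 0 else s (h \<eta>))"
  proof (intro injI)
    fix x y
    assume s: "inj s" "\<And>z. s z \<noteq> Inr 0"
      and eq: "(if x = \<xi> then Inr 0 else s (h x)) = (if y = \<xi> then Inr 0 else s (h y))"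
    show "x = y"
    proof (cases "x = \<xi> \<or> y = \<xi>")
      case True
      with eq s(2)[of "h x"] s(2)[of "h y"] show ?thesis by (auto split: if_splits)
    next
      case False
      with eq s(1) have "h x = h y" by (auto dest: injD)
      moreover from False top have "x \<in> {..<\<xi>}" "y \<in> {..<\<xi>}" by auto
      ultimately show ?thesis using h by (auto dest: inj_onD)
    qed
  qed
  then show False using no_inj_ordinal_sum by blast
qed

definition osucc :: "'o::wellorder \<Rightarrow> 'o" where
  "osucc \<xi> = (LEAST \<eta>. \<xi> < \<eta>)"

lemma less_osucc: "(\<xi> :: 'a ordinal) < osucc \<xi>"
  unfolding osucc_def using ordinal_gt_ex by (rule LeastI_ex)

lemma osucc_le_iff: "osucc \<xi> \<le> \<eta> \<longleftrightarrow> (\<xi> :: 'a ordinal) < \<eta>"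
proof
  show "\<xi> < \<eta>" if "osucc \<xi> \<le> \<eta>"
    using less_osucc that by (rule less_le_trans)
  show "osucc \<xi> \<le> \<eta>" if "\<xi> < \<eta>"
    unfolding osucc_def using that by (rule Least_le)
qed

lemma osucc_inject [simp]: "osucc \<xi> = osucc \<eta> \<longleftrightarrow> (\<xi> :: 'a ordinal) = \<eta>"
proof
  assume eq: "osucc \<xi> = osucc \<eta>"
  show "\<xi> = \<eta>"
  proof (rule ccontr)
    assume "\<xi> \<noteq> \<eta>"
    then have "osucc \<xi> \<le> \<eta> \<or> osucc \<eta> \<le> \<xi>" unfolding osucc_le_iff by auto
    then show False using eq less_osucc[of \<xi>] less_osucc[of \<eta>] by auto
  qed
qed simp


section \<open>The Cantor--Bendixson sequence\<close>

text \<open>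
  \<open>CB W \<xi>\<close> is $W^{(\xi)}$. Derived sets are formed in \<open>W\<close>; as $W^{(\xi)}$ is closed in the spaces
  of interest, this is the same as forming them in the subspace $W^{(\xi)}$.
\<close>

function CB :: "'a topology \<Rightarrow> 'a ordinal \<Rightarrow> 'a set" where
  "CB W \<xi> =
    (if \<xi> = 0 then topspace W
     else if \<exists>\<eta>. \<xi> = osucc \<eta> then W derived_set_of CB W (THE \<eta>. \<xi> = osucc \<eta>)
     else (\<Inter>\<eta>\<in>{..<\<xi>}. CB W \<eta>))"
  by pat_completeness auto
termination
proof (relation "inv_image {(\<eta>, \<xi>). \<eta> < \<xi>} snd")
  show "wf (inv_image {(\<eta>, \<xi> :: 'a ordinal). \<eta> < \<xi>} (snd :: 'a topology \<times> _ \<Rightarrow> _))"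
    by (intro wf_inv_image wf)
qed (auto simp: less_osucc)

declare CB.simps [simp del]

lemma CB_0: "CB W 0 = topspace W"
  by (subst CB.simps) simp

lemma CB_osucc: "CB W (osucc \<xi>) = W derived_set_of CB W \<xi>"
proof -
  have "osucc \<xi> \<noteq> 0"
    using less_osucc[of \<xi>] ordinal_zero_le[of \<xi>] by (metis leD)
  then show ?thesis by (subst CB.simps) simp
qed

lemma CB_limit: "\<xi> \<noteq> 0 \<Longrightarrow> \<nexists>\<eta>. \<xi> = osucc \<eta> \<Longrightarrow> CB W \<xi> = (\<Inter>\<eta>\<in>{..<\<xi>}. CB W \<eta>)"
  by (subst CB.simps) simp

text \<open>
  \<open>CB_layer\<close>, \<open>CB_rank\<close>, \<open>CB_kernel\<close>, \<open>CB_number\<close> and \<open>CB_compact_rank\<close> are $W^{[\xi]}$, $\nu(W)$,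
  $K(W)$, $n(W)$ and $\rho(W)$. The value $-\infty$ of $n(W)$ is \<open>None\<close>.
\<close>

definition CB_layer :: "'a topology \<Rightarrow> 'a ordinal \<Rightarrow> 'a set" where
  "CB_layer W \<xi> = CB W \<xi> - CB W (osucc \<xi>)"

definition CB_rank :: "'a topology \<Rightarrow> 'a ordinal" where
  "CB_rank W = (LEAST \<xi>. CB W \<xi> = CB W (osucc \<xi>))"

definition CB_kernel :: "'a topology \<Rightarrow> 'a set" where
  "CB_kernel W = CB W (CB_rank W)"

definition scattered :: "'a topology \<Rightarrow> bool" where
  "scattered W \<longleftrightarrow> CB_kernel W = {}"

definition CB_number :: "'a topology \<Rightarrow> nat option" where
  "CB_number W =
    (if \<exists>\<mu>. CB_rank W = osucc \<mu> \<and> finite (CB W \<mu> - CB_kernel W)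
     then Some (card (CB W (THE \<mu>. CB_rank W = osucc \<mu>) - CB_kernel W)) else None)"

definition CB_compact_rank :: "'a topology \<Rightarrow> 'a ordinal" where
  "CB_compact_rank W = (LEAST \<xi>. compactin W (W closure_of CB_layer W \<xi>))"

text \<open>
  The minima defining \<open>CB_rank\<close> and \<open>CB_compact_rank\<close> are attained.
\<close>

lemma CB_closed_antimono:
  assumes W: "Hausdorff_space W"
  shows "closedin W (CB W \<xi>) \<and> (\<forall>\<eta>\<le>\<xi>. CB W \<xi> \<subseteq> CB W \<eta>)"
proof (induction \<xi> rule: less_induct)
  case (less \<xi>)
  consider "\<xi> = 0" | \<zeta> where "\<xi> = osucc \<zeta>" | "\<xi> \<noteq> 0" "\<nexists>\<eta>. \<xi> = osucc \<eta>" by blast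
  then show ?case
  proof cases
    case 1
    then have "\<eta> = \<xi>" if "\<eta> \<le> \<xi>" for \<eta>
      using that ordinal_zero_le[of \<eta>] by (metis order_antisym)
    moreover have "closedin W (CB W \<xi>)" by (simp add: 1 CB_0)
    ultimately show ?thesis by blast
  next
    case 2
    have IH: "closedin W (CB W \<zeta>)" "\<And>\<eta>. \<eta> \<le> \<zeta> \<Longrightarrow> CB W \<zeta> \<subseteq> CB W \<eta>"
      using less less_osucc 2 by auto
    then have "CB W \<xi> \<subseteq> CB W \<zeta>"
      by (auto simp: 2 CB_osucc closedin_contains_derived_set)
    moreover have "\<eta> \<le> \<zeta>" if "\<eta> \<le> \<xi>" "\<eta> \<noteq> \<xi>" for \<eta>
      using that 2 osucc_le_iff[of \<zeta> \<eta>] by (metis antisym not_less)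
    moreover have "closedin W (CB W \<xi>)"
      by (simp add: 2 CB_osucc closedin_derived_set_of_gen W Hausdorff_imp_t1_space)
    ultimately show ?thesis using IH(2) by blast
  next
    case 3
    have "0 < \<xi>" using 3(1) by (metis ordinal_zero_le le_imp_less_or_eq)
    then have "closedin W (CB W \<xi>)"
      unfolding CB_limit[OF 3] using less by (intro closedin_Inter) auto
    moreover have "CB W \<xi> \<subseteq> CB W \<eta>" if "\<eta> \<le> \<xi>" for \<eta>
      using that by (cases "\<eta> = \<xi>") (auto simp: CB_limit[OF 3])
    ultimately show ?thesis by blast
  qed
qed

lemma CB_stationary:
  assumes "Hausdorff_space W"
  shows "CB W (CB_rank W) = CB W (osucc (CB_rank W))"
  unfolding CB_rank_def
proof (rule LeastI_ex, rule ccontr)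
  note mono = CB_closed_antimono[OF assms, THEN conjunct2, rule_format]
  assume "\<nexists>\<xi>. CB W \<xi> = CB W (osucc \<xi>)"
  then have "\<exists>x. x \<in> CB_layer W \<xi>" for \<xi>
    using mono[OF less_imp_le[OF less_osucc], of \<xi>] by (fastforce simp: CB_layer_def)
  then obtain x where x: "x \<xi> \<in> CB_layer W \<xi>" for \<xi> by metis
  have ne: "x \<xi> \<noteq> x \<eta>" if "\<xi> < \<eta>" for \<xi> \<eta>
    using x[of \<xi>] x[of \<eta>] mono[of "osucc \<xi>" \<eta>] that by (auto simp: CB_layer_def osucc_le_iff)
  have "inj x"
    by (rule injI) (metis ne neqE)
  then show False using no_inj_ordinal by blast
qed

lemma compactin_closure_CB_compact_rank:
  assumes "Hausdorff_space W"
  shows "compactin W (W closure_of CB_layer W (CB_compact_rank W))"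
  unfolding CB_compact_rank_def
proof (rule LeastI)
  show "compactin W (W closure_of CB_layer W (CB_rank W))"
    using CB_stationary[OF assms] by (simp add: CB_layer_def)
qed


section \<open>\<open>\<omega>\<close>-Stone spaces and primitivity\<close>

definition omega_Stone_space :: "'a topology \<Rightarrow> bool" where
  "omega_Stone_space W \<longleftrightarrow>
    locally_compact_space W \<and> metrizable_space W \<and> Hausdorff_space W \<and>
    (\<forall>x\<in>topspace W. connected_component_of_set W x = {x})"

definition compact_open_sets :: "'a topology \<Rightarrow> 'a set set" where
  "compact_open_sets W = {A. compactin W A \<and> openin W A}"

text \<open>
  For a Boolean ring \<open>R\<close> of sets, \<open>below R A\<close> is the Boolean ring $(A) = \{C \in R \mid C \subseteq A\}$,
  whose identity is \<open>A\<close>.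
\<close>

definition below :: "'a set set \<Rightarrow> 'a set \<Rightarrow> 'a set ring" where
  "below R A = \<lparr>carrier = {C \<in> R. C \<subseteq> A}, mult = (\<inter>), one = A, zero = {}, add = sym_diff\<rparr>"

definition pseudo_indecomposable :: "'a set set \<Rightarrow> 'a set \<Rightarrow> bool" where
  "pseudo_indecomposable R A \<longleftrightarrow>
    (\<forall>B\<in>R. B \<subseteq> A \<longrightarrow> below R B \<simeq> below R A \<or> below R (A - B) \<simeq> below R A)"

definition primitive_ring :: "'a set set \<Rightarrow> bool" where
  "primitive_ring R \<longleftrightarrow>
    (\<forall>A\<in>R. \<exists>\<F>. finite \<F> \<and> \<F> \<subseteq> {B \<in> R. pseudo_indecomposable R B} \<and> disjoint \<F> \<and> A = \<Union>\<F>)"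

definition primitive_space :: "'a topology \<Rightarrow> bool" where
  "primitive_space W \<longleftrightarrow> primitive_ring (compact_open_sets W)"


section \<open>PO systems\<close>

text \<open>
  A PO system consists of a carrier \<open>P\<close> and a relation \<open>lt\<close>, which need be neither reflexive
  nor irreflexive.
\<close>

definition PO_system :: "'p set \<Rightarrow> ('p \<Rightarrow> 'p \<Rightarrow> bool) \<Rightarrow> bool" where
  "PO_system P lt \<longleftrightarrow> antisymp_on P lt \<and> transp_on P lt"

definition po_le :: "('p \<Rightarrow> 'p \<Rightarrow> bool) \<Rightarrow> 'p \<Rightarrow> 'p \<Rightarrow> bool" where
  "po_le lt p q \<longleftrightarrow> lt p q \<or> p = q"

definition po_discrete :: "'p set \<Rightarrow> ('p \<Rightarrow> 'p \<Rightarrow> bool) \<Rightarrow> 'p set" where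
  "po_discrete P lt = {p \<in> P. \<not> lt p p}"

definition po_minimal :: "'p set \<Rightarrow> ('p \<Rightarrow> 'p \<Rightarrow> bool) \<Rightarrow> 'p set" where
  "po_minimal P lt = {p \<in> P. \<forall>q\<in>P. po_le lt q p \<longrightarrow> q = p}"

definition lower_subset :: "'p set \<Rightarrow> ('p \<Rightarrow> 'p \<Rightarrow> bool) \<Rightarrow> 'p set \<Rightarrow> bool" where
  "lower_subset P lt Q \<longleftrightarrow> Q \<subseteq> P \<and> (\<forall>q\<in>Q. \<forall>r\<in>P. po_le lt r q \<longrightarrow> r \<in> Q)"


section \<open>Trim partitions\<close>

definition P_partition ::
    "'a topology \<Rightarrow> 'p set \<Rightarrow> ('p \<Rightarrow> 'p \<Rightarrow> bool) \<Rightarrow> ('p \<Rightarrow> 'a set) \<Rightarrow> bool" where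
  "P_partition W P lt X \<longleftrightarrow>
    PO_system P lt \<and>
    (\<forall>p\<in>P. X p \<noteq> {} \<and> X p \<subseteq> topspace W) \<and>
    disjoint_family_on X P \<and>
    (\<forall>p\<in>P. (W derived_set_of X p) \<inter> (\<Union>q\<in>P. X q) = (\<Union>q\<in>{q \<in> P. lt q p}. X q))"

definition complete_partition :: "'a topology \<Rightarrow> 'p set \<Rightarrow> ('p \<Rightarrow> 'a set) \<Rightarrow> bool" where
  "complete_partition W P X \<longleftrightarrow> (\<Union>p\<in>P. X p) = topspace W"

definition type_of :: "'p set \<Rightarrow> ('p \<Rightarrow> 'a set) \<Rightarrow> 'a set \<Rightarrow> 'p set" where
  "type_of P X Y = {p \<in> P. Y \<inter> X p \<noteq> {}}"

definition trim_set ::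
    "'a topology \<Rightarrow> 'p set \<Rightarrow> ('p \<Rightarrow> 'p \<Rightarrow> bool) \<Rightarrow> ('p \<Rightarrow> 'a set) \<Rightarrow> 'p \<Rightarrow> 'a set \<Rightarrow> bool" where
  "trim_set W P lt X p A \<longleftrightarrow>
    A \<in> compact_open_sets W \<and>
    type_of P X A = {q \<in> P. po_le lt p q} \<and>
    (p \<in> po_discrete P lt \<longrightarrow> card (A \<inter> X p) = 1)"

definition trim_partition ::
    "'a topology \<Rightarrow> 'p set \<Rightarrow> ('p \<Rightarrow> 'p \<Rightarrow> bool) \<Rightarrow> ('p \<Rightarrow> 'a set) \<Rightarrow> bool" where
  "trim_partition W P lt X \<longleftrightarrow>
    P_partition W P lt X \<and>
    (\<forall>x\<in>topspace W. neighbourhood_base_at x (\<lambda>A. \<exists>p\<in>P. trim_set W P lt X p A) W) \<and>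
    (\<forall>p\<in>P. \<forall>x\<in>topspace W. neighbourhood_base_at x (trim_set W P lt X p) W \<longrightarrow> x \<in> X p) \<and>
    (\<forall>p\<in>P. \<forall>x\<in>X p. \<exists>A. trim_set W P lt X p A \<and> x \<in> A)"

text \<open>
  The function $f\colon L^d_{\min} \to \mathbb{N}_+$ is a partial function with domain exactly
  $L^d_{\min}$.
\<close>

definition trim_PLf_partition ::
    "'a topology \<Rightarrow> 'p set \<Rightarrow> ('p \<Rightarrow> 'p \<Rightarrow> bool) \<Rightarrow> 'p set \<Rightarrow> ('p \<rightharpoonup> nat) \<Rightarrow> ('p \<Rightarrow> 'a set) \<Rightarrow> bool" where
  "trim_PLf_partition W P lt L f X \<longleftrightarrow>
    lower_subset P lt L \<and>
    dom f = po_minimal L lt \<inter> po_discrete P lt \<and> (\<forall>n\<in>ran f. 0 < n) \<and>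
    trim_partition W P lt X \<and>
    (\<forall>p\<in>P. compactin W (W closure_of X p) \<longleftrightarrow> p \<in> L) \<and>
    (\<forall>p\<in>dom f. finite (X p) \<and> f p = Some (card (X p)))"


section \<open>The PO system of a scattered space\<close>

definition N_carrier :: "'o::wellorder \<Rightarrow> 'o set" where
  "N_carrier \<nu> = {\<xi>. \<xi> < \<nu>}"

definition N_lt :: "'o::wellorder \<Rightarrow> 'o \<Rightarrow> bool" where
  "N_lt p q \<longleftrightarrow> p > q"

definition P_of :: "'a topology \<Rightarrow> 'a ordinal set" where
  "P_of W = N_carrier (CB_rank W)"

definition L_of :: "'a topology \<Rightarrow> 'a ordinal set" where
  "L_of W = {\<xi> \<in> P_of W. \<xi> \<ge> CB_compact_rank W}"

definition f_of :: "'a topology \<Rightarrow> 'a ordinal \<rightharpoonup> nat" where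
  "f_of W =
    (if CB_compact_rank W = CB_rank W then Map.empty
     else (\<lambda>\<mu>. if CB_rank W = osucc \<mu> then CB_number W else None))"

end

theory Submission
  imports Defs
begin

text \<open>
  In a scattered space $W^{[\xi]}$ is dense in $W^{(\xi)}$, so its derived set is $W^{(\xi+1)}$. A point
  of $W^{[\xi]}$ has arbitrarily small compact open neighbourhoods meeting $W^{(\xi)}$ in that point
  only, and by density these are $\xi$-trim; this gives the partition. If $\rho(W) < \nu(W)$,
  then $W^{(\rho(W))}$ is compact and nonempty, so its last nonempty derived set is finite.

  A nonempty compact open set has a type $(\mu, n)$: $\mu$ is the largest index at which it meets
  $W^{(\mu)}$, in $n$ points. Types have a splitting property, so sets of equal type have isomorphic
  rings of compact open subsets, by Vaught's back-and-forth argument for countable Boolean rings. Hence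
  a set of type $(\mu, 1)$ is pseudo-indecomposable, since one of any two complementary parts contains
  its single point of rank $\mu$, and a set of type $(\mu, n)$ splits into $n$ sets of type $(\mu, 1)$.
\<close>

section \<open>Back and forth\<close>

text \<open>A finite stage of the construction: partitions of \<open>A\<close> and \<open>B\<close>
  with their pieces matched. Storing a set of pairs, that is a relation, lets the two sides be
  exchanged by taking the converse.\<close>

definition paired_partition ::
    "('a set \<Rightarrow> 'b set \<Rightarrow> bool) \<Rightarrow> 'a set \<Rightarrow> 'b set \<Rightarrow> ('a set \<times> 'b set) set \<Rightarrow> bool" where
  "paired_partition E A B S \<longleftrightarrow>
    finite S \<and> (\<forall>p\<in>S. E (fst p) (snd p)) \<and> \<Union>(fst ` S) = A \<and> \<Union>(snd ` S) = B \<and>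
    (\<forall>p\<in>S. \<forall>q\<in>S. p \<noteq> q \<longrightarrow> fst p \<inter> fst q = {} \<and> snd p \<inter> snd q = {})"

definition pair_refines :: "('a set \<times> 'b set) set \<Rightarrow> ('a set \<times> 'b set) set \<Rightarrow> bool" where
  "pair_refines S' S \<longleftrightarrow> (\<forall>p'\<in>S'. \<exists>p\<in>S. fst p' \<subseteq> fst p \<and> snd p' \<subseteq> snd p)"

text \<open>For \<open>c\<close> inside \<open>A\<close> and \<open>d\<close> inside
  \<open>B\<close>, this makes \<open>c\<close> and \<open>d\<close> unions of matched pieces of the
  stage \<open>S\<close>. It is the finite approximation of the isomorphism sending \<open>c\<close>
  to \<open>d\<close>.\<close>

definition corresponds :: "('a set \<times> 'b set) set \<Rightarrow> 'a set \<Rightarrow> 'b set \<Rightarrow> bool" where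
  "corresponds S c d \<longleftrightarrow>
    (\<forall>p\<in>S. fst p \<subseteq> c \<and> snd p \<subseteq> d \<or> fst p \<inter> c = {} \<and> snd p \<inter> d = {})"

lemma pair_refines_refl: "pair_refines S S"
  by (auto simp: pair_refines_def)

lemma pair_refines_trans: "pair_refines S T \<Longrightarrow> pair_refines T U \<Longrightarrow> pair_refines S U"
  unfolding pair_refines_def by (meson order_trans)

lemma corresponds_refines: "corresponds S c d \<Longrightarrow> pair_refines S' S \<Longrightarrow> corresponds S' c d"
  unfolding corresponds_def pair_refines_def by (smt (verit, best) disjoint_iff subset_eq)

text \<open>This and the next two lemmas reduce the "back" half of a step to the "forth"
  half.\<close>

lemma paired_partition_converse:
  "paired_partition E A B S \<Longrightarrow> paired_partition E\<inverse>\<inverse> B A (S\<inverse>)"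
  unfolding paired_partition_def by (fastforce simp: image_iff)

lemma pair_refines_converse: "pair_refines S' S \<Longrightarrow> pair_refines (S'\<inverse>) (S\<inverse>)"
  unfolding pair_refines_def by (auto simp: Ball_def Bex_def; metis fst_conv snd_conv)

lemma corresponds_converse: "corresponds S c d \<Longrightarrow> corresponds (S\<inverse>) d c"
  unfolding corresponds_def by fastforce

text \<open>A point of \<open>B\<close> lies in some piece \<open>snd p\<close>, and its partner
  \<open>fst p\<close> is nonempty. A nonempty piece cannot both lie in \<open>c\<close> and miss
  \<open>c\<close>, so \<open>p\<close> makes the same choice for \<open>d\<close> and for
  \<open>d'\<close>.\<close>

lemma corresponds_unique:
  assumes "paired_partition E A B S" "\<And>C D. E C D \<Longrightarrow> C = {} \<Longrightarrow> D = {}"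
    and "corresponds S c d" "corresponds S c d'" "d \<subseteq> B" "d' \<subseteq> B"
  shows "d = d'"
proof -
  have "x \<in> d \<longleftrightarrow> x \<in> d'" if x: "x \<in> B" for x
  proof -
    obtain p where p: "p \<in> S" "x \<in> snd p"
      using x assms(1) unfolding paired_partition_def by blast
    with assms(1) have "E (fst p) (snd p)"
      unfolding paired_partition_def by blast
    with assms(2) p(2) obtain y where y: "y \<in> fst p" by blast
    have "fst p \<subseteq> c \<and> snd p \<subseteq> d \<or> fst p \<inter> c = {} \<and> snd p \<inter> d = {}"
      "fst p \<subseteq> c \<and> snd p \<subseteq> d' \<or> fst p \<inter> c = {} \<and> snd p \<inter> d' = {}"
      using assms(3,4) p(1) unfolding corresponds_def by auto
    with p(2) y show ?thesis by auto
  qed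
  with assms(5,6) show ?thesis by blast
qed

text \<open>The "forth" half of a step: each piece of \<open>A\<close> is cut along
  \<open>a\<close>, the splitting property cuts its partner accordingly, and \<open>d\<close>
  collects the partners of the parts inside \<open>a\<close>.\<close>

lemma paired_partition_split:
  assumes S: "paired_partition E A B S" and a: "a \<in> R"
    and R: "{} \<in> R" "\<And>C D. C \<in> R \<Longrightarrow> D \<in> R \<Longrightarrow> C \<union> D \<in> R"
    and split: "\<And>C D. E C D \<Longrightarrow> \<exists>D'\<in>R. D' \<subseteq> D \<and> E (C \<inter> a) D' \<and> E (C - a) (D - D')"
  shows "\<exists>S' d. paired_partition E A B S' \<and> pair_refines S' S \<and> d \<in> R \<and> d \<subseteq> B \<and> corresponds S' a d"
proof -
  have fin: "finite S" and E: "\<And>p. p \<in> S \<Longrightarrow> E (fst p) (snd p)"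
    and AB: "\<Union>(fst ` S) = A" "\<Union>(snd ` S) = B"
    and disj: "\<And>p q. p \<in> S \<Longrightarrow> q \<in> S \<Longrightarrow> p \<noteq> q \<Longrightarrow> fst p \<inter> fst q = {}"
      "\<And>p q. p \<in> S \<Longrightarrow> q \<in> S \<Longrightarrow> p \<noteq> q \<Longrightarrow> snd p \<inter> snd q = {}"
    using S unfolding paired_partition_def by blast+
  have "\<forall>p\<in>S. \<exists>D'. D' \<in> R \<and> D' \<subseteq> snd p \<and> E (fst p \<inter> a) D' \<and> E (fst p - a) (snd p - D')"
    using split E by blast
  then obtain f where f: "\<And>p. p \<in> S \<Longrightarrow> f p \<in> R" "\<And>p. p \<in> S \<Longrightarrow> f p \<subseteq> snd p"
      "\<And>p. p \<in> S \<Longrightarrow> E (fst p \<inter> a) (f p)" "\<And>p. p \<in> S \<Longrightarrow> E (fst p - a) (snd p - f p)"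
    by (metis bchoice)
  \<comment> \<open>Parts may be empty here; since \<open>E\<close> holds for each new pair, they do
    no harm to later stages.\<close>
  define S' where "S' = (\<lambda>p. (fst p \<inter> a, f p)) ` S \<union> (\<lambda>p. (fst p - a, snd p - f p)) ` S"
  have S'_cases: "\<exists>p\<in>S. q = (fst p \<inter> a, f p) \<or> q = (fst p - a, snd p - f p)" if "q \<in> S'" for q
    using that by (auto simp: S'_def)
  have E': "\<forall>q\<in>S'. E (fst q) (snd q)"
  proof
    fix q assume "q \<in> S'"
    then obtain p where "p \<in> S" "q = (fst p \<inter> a, f p) \<or> q = (fst p - a, snd p - f p)"
      using S'_cases by meson
    with f(3,4)[of p] show "E (fst q) (snd q)" by auto
  qed
  have fin': "finite S'" using fin by (simp add: S'_def)
  have "fst p \<inter> fst q = {} \<and> snd p \<inter> snd q = {}" if pq: "p \<in> S'" "q \<in> S'" "p \<noteq> q" for p q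
  proof -
    obtain p0 q0 where p0: "p0 \<in> S" "p = (fst p0 \<inter> a, f p0) \<or> p = (fst p0 - a, snd p0 - f p0)"
      and q0: "q0 \<in> S" "q = (fst q0 \<inter> a, f q0) \<or> q = (fst q0 - a, snd q0 - f q0)"
      using S'_cases pq by meson
    show ?thesis
    proof (cases "p0 = q0")
      case True
      then show ?thesis using p0 q0 pq(3) by auto
    next
      case False
      moreover have "fst p \<subseteq> fst p0" "snd p \<subseteq> snd p0" "fst q \<subseteq> fst q0" "snd q \<subseteq> snd q0"
        using p0 q0 f(2)[of p0] f(2)[of q0] by auto
      ultimately show ?thesis using disj[OF p0(1) q0(1)] by blast
    qed
  qed
  then have "\<forall>p\<in>S'. \<forall>q\<in>S'. p \<noteq> q \<longrightarrow> fst p \<inter> fst q = {} \<and> snd p \<inter> snd q = {}"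
    by blast
  moreover have "\<Union>(fst ` S') = A"
    unfolding S'_def AB[symmetric] by (auto simp del: split_paired_All)
  moreover have "\<Union>(snd ` S') = (\<Union>p\<in>S. f p \<union> (snd p - f p))"
    unfolding S'_def by (auto simp del: split_paired_All)
  then have "\<Union>(snd ` S') = B"
    using f(2) unfolding AB[symmetric] by (simp add: Un_absorb1)
  ultimately have "paired_partition E A B S'"
    unfolding paired_partition_def
    using E' fin' by blast
  moreover have "pair_refines S' S"
    unfolding pair_refines_def
  proof
    fix q assume "q \<in> S'"
    then obtain p where "p \<in> S" "q = (fst p \<inter> a, f p) \<or> q = (fst p - a, snd p - f p)"
      using S'_cases by meson
    with f(2)[of p] show "\<exists>p\<in>S. fst q \<subseteq> fst p \<and> snd q \<subseteq> snd p"
      by (intro bexI[of _ p]) auto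
  qed
  moreover have "\<Union>(f ` T) \<in> R" if "finite T" "T \<subseteq> S" for T
    using that by (induction T) (auto simp: R f(1))
  then have "\<Union>(f ` S) \<in> R" using fin by blast
  moreover have "\<Union>(f ` S) \<subseteq> B" using f(2) AB(2) by blast
  moreover have "corresponds S' a (\<Union>(f ` S))"
    unfolding corresponds_def
  proof
    fix q assume "q \<in> S'"
    then obtain p where p: "p \<in> S" "q = (fst p \<inter> a, f p) \<or> q = (fst p - a, snd p - f p)"
      using S'_cases by meson
    have "(snd p - f p) \<inter> f p' = {}" if "p' \<in> S" for p'
      using disj(2)[OF p(1) that] f(2)[OF that] by (cases "p = p'") auto
    with p show "fst q \<subseteq> a \<and> snd q \<subseteq> \<Union>(f ` S) \<or> fst q \<inter> a = {} \<and> snd q \<inter> \<Union>(f ` S) = {}"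
      by (elim disjE) auto
  qed
  ultimately show ?thesis by blast
qed

text \<open>Vaught's theorem: the splitting property of \<open>E\<close> drives a back-and-forth construction.\<close>

theorem below_iso_if_back_and_forth:
  assumes R: "{} \<in> R" "\<And>C D. C \<in> R \<Longrightarrow> D \<in> R \<Longrightarrow> C \<union> D \<in> R"
      "\<And>C D. C \<in> R \<Longrightarrow> D \<in> R \<Longrightarrow> C \<inter> D \<in> R" "\<And>C D. C \<in> R \<Longrightarrow> D \<in> R \<Longrightarrow> C - D \<in> R"
    and countable: "countable {C \<in> R. C \<subseteq> A}" "countable {C \<in> R. C \<subseteq> B}"
    and E_R: "\<And>C D. E C D \<Longrightarrow> C \<in> R"
    and E_sym: "\<And>C D. E C D \<Longrightarrow> E D C"
    and E_empty: "\<And>C D. E C D \<Longrightarrow> C = {} \<Longrightarrow> D = {}"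
    and split: "\<And>C D C'. E C D \<Longrightarrow> C' \<in> R \<Longrightarrow> C' \<subseteq> C \<Longrightarrow>
      \<exists>D'\<in>R. D' \<subseteq> D \<and> E C' D' \<and> E (C - C') (D - D')"
    and AB: "E A B"
  shows "below R A \<simeq> below R B"
proof -
  \<comment> \<open>Symmetry of \<open>E\<close> is what allows the converse of a stage to be a
    stage for the same \<open>E\<close>.\<close>
  have [simp]: "E\<inverse>\<inverse> = E" using E_sym by blast
  have split': "\<exists>D'\<in>R. D' \<subseteq> D \<and> E (C \<inter> a) D' \<and> E (C - a) (D - D')" if "E C D" "a \<in> R" for C D a
    using split[of C D "C \<inter> a"] that E_R R(3) by (simp add: Diff_Int)
  have AR: "A \<in> R" and BR: "B \<in> R" using AB E_R E_sym by blast+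
  \<comment> \<open>Enumerations of the two countable rings, onto because \<open>{}\<close> belongs
    to both. Repetitions are harmless.\<close>
  define a where "a = from_nat_into {C \<in> R. C \<subseteq> A}"
  define b where "b = from_nat_into {C \<in> R. C \<subseteq> B}"
  have a: "range a = {C \<in> R. C \<subseteq> A}" and b: "range b = {C \<in> R. C \<subseteq> B}"
    unfolding a_def b_def using countable R(1) by (intro range_from_nat_into; blast)+
  have aR: "a n \<in> R" and bR: "b n \<in> R" for n
    using a b by blast+
  \<comment> \<open>Step \<open>n\<close> must find a partner in \<open>B\<close> for
    \<open>a n\<close> and a partner in \<open>A\<close> for \<open>b n\<close>. Later refinements
    preserve both.\<close>
  define Q where "Q n S S' \<longleftrightarrow> pair_refines S' S \<and>
    (\<exists>d\<in>R. d \<subseteq> B \<and> corresponds S' (a n) d) \<and> (\<exists>c\<in>R. c \<subseteq> A \<and> corresponds S' c (b n))" for n S S'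
  have "\<exists>S. \<forall>n. paired_partition E A B (S n) \<and> Q n (S n) (S (Suc n))"
  proof (rule dependent_nat_choice)
    show "\<exists>S. paired_partition E A B S"
      using AB by (intro exI[of _ "{(A, B)}"]) (simp add: paired_partition_def)
  next
    fix S n assume S: "paired_partition E A B S"
    obtain S1 d where S1: "paired_partition E A B S1" "pair_refines S1 S"
        "d \<in> R" "d \<subseteq> B" "corresponds S1 (a n) d"
      using paired_partition_split[OF S aR R(1,2) split'] aR by blast
    \<comment> \<open>The "back" half: the same splitting, applied to the converse of the stage just
      built.\<close>
    have "paired_partition E B A (S1\<inverse>)"
      using paired_partition_converse[OF S1(1)] by simp
    from paired_partition_split[OF this bR R(1,2) split'] bR
    obtain S2 c where S2: "paired_partition E B A S2" "pair_refines S2 (S1\<inverse>)"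
        "c \<in> R" "c \<subseteq> A" "corresponds S2 (b n) c"
      by blast
    have "paired_partition E A B (S2\<inverse>)" "pair_refines (S2\<inverse>) S1" "corresponds (S2\<inverse>) c (b n)"
      using paired_partition_converse[OF S2(1)] pair_refines_converse[OF S2(2)]
        corresponds_converse[OF S2(5)] by auto
    then show "\<exists>S'. paired_partition E A B S' \<and> Q n S S'"
      unfolding Q_def using S1(3,4) S2(3,4) pair_refines_trans[OF _ S1(2)] corresponds_refines[OF S1(5)]
      by (intro exI[of _ "S2\<inverse>"]) auto
  qed
  then obtain S where S: "\<And>n. paired_partition E A B (S n)" and Q: "\<And>n. Q n (S n) (S (Suc n))"
    by blast
  have refines: "pair_refines (S n) (S m)" if "m \<le> n" for m n
    using that
  proof (induction rule: dec_induct)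
    case (step n)
    then show ?case using Q[of n] pair_refines_trans unfolding Q_def by blast
  qed (rule pair_refines_refl)
  \<comment> \<open>The graph of the isomorphism: the union of the correspondences of all
    stages.\<close>
  define G where "G c d \<longleftrightarrow> c \<in> R \<and> c \<subseteq> A \<and> d \<in> R \<and> d \<subseteq> B \<and> (\<exists>n. corresponds (S n) c d)" for c d
  \<comment> \<open>Stages refine each other, so two related pairs can always be compared at a
    single stage. Uniqueness and compatibility with the operations are checked there.\<close>
  have common: "\<exists>n. corresponds (S n) c d \<and> corresponds (S n) c' d'"
    if G: "G c d" "G c' d'" for c d c' d'
  proof -
    obtain m m' where "corresponds (S m) c d" "corresponds (S m') c' d'"
      using G unfolding G_def by blast
    then show ?thesis
      using refines[of m "max m m'"] refines[of m' "max m m'"] corresponds_refines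
      by (intro exI[of _ "max m m'"]) auto
  qed
  have right_unique: "d = d'" if G: "G c d" "G c d'" for c d d'
  proof -
    obtain n where n: "corresponds (S n) c d" "corresponds (S n) c d'"
      using common[OF G] by blast
    show ?thesis
      by (rule corresponds_unique[OF S _ n]) (use E_empty G in \<open>auto simp: G_def\<close>)
  qed
  have left_unique: "c = c'" if G: "G c d" "G c' d" for c c' d
  proof -
    obtain n where n: "corresponds (S n) c d" "corresponds (S n) c' d"
      using common[OF G] by blast
    have "paired_partition E B A ((S n)\<inverse>)"
      using paired_partition_converse[OF S] by simp
    then show ?thesis
      by (rule corresponds_unique[OF _ _ n[THEN corresponds_converse]])
        (use E_empty G in \<open>auto simp: G_def\<close>)
  qed
  have left_total: "\<exists>d. G c d" if c: "c \<in> R" "c \<subseteq> A" for c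
  proof -
    obtain n where "c = a n" using a c by blast
    then show ?thesis using Q[of n] c unfolding Q_def G_def by blast
  qed
  have right_total: "\<exists>c. G c d" if d: "d \<in> R" "d \<subseteq> B" for d
  proof -
    obtain n where "d = b n" using b d by blast
    then show ?thesis using Q[of n] d unfolding Q_def G_def by blast
  qed
  define h where "h c = (THE d. G c d)" for c
  have h_eq: "h c = d" if "G c d" for c d
    unfolding h_def using that right_unique by (intro the_equality)
  have G_h: "G c (h c)" if "c \<in> R" "c \<subseteq> A" for c
    using left_total[OF that] h_eq by blast
  have int: "G (c \<inter> c') (d \<inter> d')" if "G c d" "G c' d'" for c d c' d'
  proof -
    obtain n where "corresponds (S n) c d" "corresponds (S n) c' d'"
      using common[OF \<open>G c d\<close> \<open>G c' d'\<close>] by blast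
    then have "corresponds (S n) (c \<inter> c') (d \<inter> d')"
      unfolding corresponds_def by blast
    then show ?thesis using that R unfolding G_def by blast
  qed
  \<comment> \<open>Symmetric difference is the addition of \<open>below\<close>.\<close>
  have diff: "G (sym_diff c c') (sym_diff d d')" if "G c d" "G c' d'" for c d c' d'
  proof -
    obtain n where "corresponds (S n) c d" "corresponds (S n) c' d'"
      using common[OF \<open>G c d\<close> \<open>G c' d'\<close>] by blast
    then have "corresponds (S n) (sym_diff c c') (sym_diff d d')"
      unfolding corresponds_def by blast
    moreover have "sym_diff c c' \<in> R" "sym_diff d d' \<in> R"
      using that R unfolding G_def by auto
    moreover have "sym_diff c c' \<subseteq> A" "sym_diff d d' \<subseteq> B"
      using that unfolding G_def by auto
    ultimately show ?thesis unfolding G_def by blast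
  qed
  have one: "G A B"
  proof -
    have "corresponds (S 0) A B"
      using S[of 0] unfolding corresponds_def paired_partition_def by blast
    then show ?thesis using AR BR unfolding G_def by blast
  qed
  have "h \<in> ring_iso (below R A) (below R B)"
  proof (rule ring_iso_memI)
    show "bij_betw h (carrier (below R A)) (carrier (below R B))"
      unfolding bij_betw_def
    proof
      show "inj_on h (carrier (below R A))"
        by (rule inj_onI) (metis (no_types, lifting) G_h left_unique below_def partial_object.simps(1) mem_Collect_eq)
      show "h ` carrier (below R A) = carrier (below R B)"
      proof
        show "h ` carrier (below R A) \<subseteq> carrier (below R B)"
          using G_h by (auto simp: below_def G_def)
        show "carrier (below R B) \<subseteq> h ` carrier (below R A)"
        proof
          fix d assume "d \<in> carrier (below R B)"
          then obtain c where c: "G c d" using right_total by (auto simp: below_def)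
          then have "c \<in> carrier (below R A)" by (simp add: below_def G_def)
          with h_eq[OF c] show "d \<in> h ` carrier (below R A)" by blast
        qed
      qed
    qed
  next
    fix c c' assume "c \<in> carrier (below R A)" "c' \<in> carrier (below R A)"
    then have "G c (h c)" "G c' (h c')" using G_h by (auto simp: below_def)
    then show "h (c \<otimes>\<^bsub>below R A\<^esub> c') = h c \<otimes>\<^bsub>below R B\<^esub> h c'"
      and "h (c \<oplus>\<^bsub>below R A\<^esub> c') = h c \<oplus>\<^bsub>below R B\<^esub> h c'"
      using h_eq[OF int] h_eq[OF diff] by (simp_all add: below_def)
  next
    show "h \<one>\<^bsub>below R A\<^esub> = \<one>\<^bsub>below R B\<^esub>"
      using h_eq[OF one] by (simp add: below_def)
  qed (use G_h in \<open>auto simp: below_def G_def\<close>)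
  then show ?thesis by (auto simp: is_ring_iso_def)
qed

section \<open>Compact open sets\<close>

locale omega_Stone =
  fixes W :: "'a topology"
  assumes omega_Stone: "omega_Stone_space W"
begin

lemma Hausdorff: "Hausdorff_space W"
  using omega_Stone by (simp add: omega_Stone_space_def)

lemma compact_open_closed: "A \<in> compact_open_sets W \<Longrightarrow> closedin W A"
  using Hausdorff by (auto simp: compact_open_sets_def intro: compactin_imp_closedin)

lemma compact_open_empty: "{} \<in> compact_open_sets W"
  by (simp add: compact_open_sets_def)

lemma compact_open_Un:
  "A \<in> compact_open_sets W \<Longrightarrow> B \<in> compact_open_sets W \<Longrightarrow> A \<union> B \<in> compact_open_sets W"
  by (auto simp: compact_open_sets_def compactin_Un)

lemma compact_open_Int:
  "A \<in> compact_open_sets W \<Longrightarrow> B \<in> compact_open_sets W \<Longrightarrow> A \<inter> B \<in> compact_open_sets W"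
  using compactin_Int[OF Hausdorff] by (auto simp: compact_open_sets_def)

lemma compact_open_Diff:
  assumes "A \<in> compact_open_sets W" "B \<in> compact_open_sets W"
  shows "A - B \<in> compact_open_sets W"
proof -
  have "openin W (A - B)"
    using assms compact_open_closed by (auto simp: compact_open_sets_def)
  moreover have "closedin W (A - B)"
    using assms compact_open_closed by (auto simp: compact_open_sets_def)
  then have "compactin W (A - B)"
    using assms(1) closed_compactin[of W A "A - B"] by (auto simp: compact_open_sets_def)
  ultimately show ?thesis by (simp add: compact_open_sets_def)
qed

text \<open>In a locally compact Hausdorff space a compact component has clopen neighbourhoods
  inside any open set containing it. The component here is \<open>{x}\<close>, and shrinking the
  open set into a compact \<open>K\<close> makes the clopen neighbourhood compact.\<close>

lemma compact_open_nbhd: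
  assumes "openin W U" "x \<in> U"
  obtains A where "A \<in> compact_open_sets W" "x \<in> A" "A \<subseteq> U"
proof -
  have x: "x \<in> topspace W" using assms openin_subset by blast
  have lc: "locally_compact_space W"
    using omega_Stone by (simp add: omega_Stone_space_def)
  then obtain V K where VK: "openin W V" "compactin W K" "x \<in> V" "V \<subseteq> K"
    using x unfolding locally_compact_space_def by blast
  have "connected_component_of_set W x = {x}"
    using omega_Stone x by (simp add: omega_Stone_space_def)
  then have comp: "{x} \<in> connected_components_of W"
    using x by (auto simp: connected_components_of_def image_iff intro!: bexI[of _ x])
  have "openin W (U \<inter> V)" "{x} \<subseteq> U \<inter> V" "compactin W {x}"
    using assms VK x by auto
  from wilder_locally_compact_component_thm[OF lc Hausdorff comp this(3,1,2)]
  obtain A B where AB: "openin W A" "openin W B" "disjnt A B" "A \<union> B = topspace W" "{x} \<subseteq> A" "A \<subseteq> U \<inter> V"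
    by blast
  have "topspace W - A = B" "A \<subseteq> topspace W"
    using AB(3,4) by (auto simp: disjnt_def)
  then have "closedin W A" using AB(2) by (simp add: closedin_def)
  then have "compactin W A"
    using closed_compactin[OF VK(2)] AB VK by blast
  then show thesis
    using that[of A] AB by (simp add: compact_open_sets_def)
qed

text \<open>By the Lebesgue number of the cover of \<open>A\<close> by \<open>C\<close> and
  \<open>A - C\<close>, every sufficiently small ball centred in \<open>A\<close> lies in one of the
  two. Hence \<open>C\<close> is the trace on \<open>A\<close> of finitely many balls centred in a
  fixed finite net \<open>K n\<close>, which leaves countably many choices.\<close>

lemma countable_compact_open_below:
  assumes A: "A \<in> compact_open_sets W"
  shows "countable {C \<in> compact_open_sets W. C \<subseteq> A}"
proof -
  obtain M d where "Metric_space M d" and W: "W = Metric_space.mtopology M d"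
    using omega_Stone by (auto simp: omega_Stone_space_def metrizable_space_def)
  then interpret Metric_space M d by simp
  have cA: "compactin mtopology A"
    using A W by (simp add: compact_open_sets_def)
  then have "mtotally_bounded A" by (rule compactin_imp_mtotally_bounded)
  then have "\<exists>K. finite K \<and> K \<subseteq> A \<and> A \<subseteq> (\<Union>x\<in>K. mball x (inverse (real (Suc n))))" for n
    unfolding mtotally_bounded_def by simp
  then obtain K where K: "\<And>n. finite (K n)" "\<And>n. K n \<subseteq> A"
      "\<And>n. A \<subseteq> (\<Union>x\<in>K n. mball x (inverse (real (Suc n))))"
    by metis
  define g where "g n F = A \<inter> (\<Union>x\<in>F. mball x (inverse (real (Suc n))))" for n F
  have "C \<in> (\<Union>n. g n ` Pow (K n))" if "C \<in> compact_open_sets W" "C \<subseteq> A" for C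
  proof -
    have "openin mtopology U" if "U \<in> {C, A - C}" for U
      using that A compact_open_Diff[OF A \<open>C \<in> _\<close>] \<open>C \<in> compact_open_sets W\<close>
      by (auto simp: compact_open_sets_def W)
    then obtain \<epsilon> where \<epsilon>: "\<epsilon> > 0" "\<And>x. x \<in> A \<Longrightarrow> mball x \<epsilon> \<subseteq> C \<or> mball x \<epsilon> \<subseteq> A - C"
      using lebesgue_number[OF cA, of "{C, A - C}"] by auto
    obtain n where n: "inverse (real (Suc n)) < \<epsilon>"
      using reals_Archimedean \<epsilon>(1) by blast
    have ball: "mball x (inverse (real (Suc n))) \<subseteq> C \<or> mball x (inverse (real (Suc n))) \<subseteq> A - C"
      if "x \<in> A" for x
      using \<epsilon>(2)[OF that] mball_subset_concentric[of "inverse (real (Suc n))" \<epsilon> x] n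
      by (meson less_imp_le subset_trans)
    have "A \<subseteq> M" using compactin_subset_topspace[OF cA] by simp
    then have self: "x \<in> mball x (inverse (real (Suc n)))" if "x \<in> A" for x
      using that by (intro centre_in_mball_iff[THEN iffD2]) auto
    have "C = g n (K n \<inter> C)"
    proof
      show "C \<subseteq> g n (K n \<inter> C)"
      proof
        fix y assume y: "y \<in> C"
        then obtain x where x: "x \<in> K n" "y \<in> mball x (inverse (real (Suc n)))"
          using K(3)[of n] \<open>C \<subseteq> A\<close> by blast
        then have "x \<in> A" using K(2) by blast
        with ball[of x] self[of x] x y have "x \<in> C" by blast
        with x y \<open>C \<subseteq> A\<close> show "y \<in> g n (K n \<inter> C)" by (auto simp: g_def)
      qed
      show "g n (K n \<inter> C) \<subseteq> C"
        unfolding g_def using ball self \<open>C \<subseteq> A\<close> by blast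
    qed
    then show ?thesis by blast
  qed
  then have "{C \<in> compact_open_sets W. C \<subseteq> A} \<subseteq> (\<Union>n. g n ` Pow (K n))" by blast
  moreover have "countable (\<Union>n. g n ` Pow (K n))"
    using K(1) by (intro countable_UN) (auto intro: countable_finite)
  ultimately show ?thesis by (rule countable_subset)
qed

section \<open>The Cantor--Bendixson filtration\<close>

lemma CB_closed: "closedin W (CB W \<xi>)"
  using CB_closed_antimono[OF Hausdorff] by blast

lemma CB_antimono: "\<eta> \<le> \<xi> \<Longrightarrow> CB W \<xi> \<subseteq> CB W \<eta>"
  using CB_closed_antimono[OF Hausdorff] by blast

lemma CB_osucc_subset: "CB W (osucc \<xi>) \<subseteq> CB W \<xi>"
  using CB_antimono less_osucc less_imp_le by blast

lemma CB_subset_topspace: "CB W \<xi> \<subseteq> topspace W"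
  using CB_closed closedin_subset by blast

lemma CB_layer_subset_topspace: "CB_layer W \<xi> \<subseteq> topspace W"
  using CB_subset_topspace by (auto simp: CB_layer_def)

lemma CB_layer_less: "x \<in> CB_layer W \<eta> \<Longrightarrow> x \<in> CB W \<xi> \<longleftrightarrow> \<xi> \<le> \<eta>"
  using CB_antimono[of "osucc \<eta>" \<xi>] CB_antimono[of \<xi> \<eta>]
  by (cases "\<xi> \<le> \<eta>") (auto simp: CB_layer_def osucc_le_iff not_le)

lemma CB_layer_unique: "x \<in> CB_layer W \<eta> \<Longrightarrow> x \<in> CB_layer W \<xi> \<Longrightarrow> \<eta> = \<xi>"
  using CB_layer_less[of x \<eta> \<xi>] CB_layer_less[of x \<xi> \<eta>] by (auto simp: CB_layer_def)

text \<open>The least index at which \<open>C\<close> is missed is not \<open>0\<close> because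
  \<open>C\<close> is nonempty, and not a limit because \<open>C\<close> is compact; so it is a
  successor.\<close>

lemma first_missed_CB:
  assumes C: "compactin W C" "C \<noteq> {}" "C \<inter> CB W \<xi> = {}"
  obtains \<mu> where "\<mu> < \<xi>" "C \<inter> CB W \<mu> \<noteq> {}" "C \<inter> CB W (osucc \<mu>) = {}"
proof -
  define \<zeta> where "\<zeta> = (LEAST \<zeta>. C \<inter> CB W \<zeta> = {})"
  have \<zeta>: "C \<inter> CB W \<zeta> = {}" unfolding \<zeta>_def using C(3) by (rule LeastI)
  have "\<zeta> \<le> \<xi>" unfolding \<zeta>_def using C(3) by (rule Least_le)
  have below: "C \<inter> CB W \<eta> \<noteq> {}" if "\<eta> < \<zeta>" for \<eta>
    using that not_less_Least unfolding \<zeta>_def by blast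
  have CW: "C \<subseteq> topspace W" using C(1) by (rule compactin_subset_topspace)
  have "\<zeta> \<noteq> 0" using \<zeta> C(2) CW by (auto simp: CB_0 Int_absorb2)
  have "\<exists>\<mu>. \<zeta> = osucc \<mu>"
  proof (rule ccontr)
    assume "\<nexists>\<mu>. \<zeta> = osucc \<mu>"
    from \<zeta> CB_limit[OF \<open>\<zeta> \<noteq> 0\<close> this] have "C \<inter> (\<Inter>\<eta>\<in>{..<\<zeta>}. CB W \<eta>) = {}" by simp
    with CW have "C \<subseteq> \<Union>((\<lambda>\<eta>. topspace W - CB W \<eta>) ` {..<\<zeta>})" by blast
    moreover have "openin W U" if "U \<in> (\<lambda>\<eta>. topspace W - CB W \<eta>) ` {..<\<zeta>}" for U
      using that CB_closed by auto
    ultimately obtain \<F> where \<F>: "finite \<F>" "\<F> \<subseteq> (\<lambda>\<eta>. topspace W - CB W \<eta>) ` {..<\<zeta>}" "C \<subseteq> \<Union>\<F>"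
      using C(1) unfolding compactin_def by meson
    then obtain I where I: "finite I" "I \<subseteq> {..<\<zeta>}" "\<F> = (\<lambda>\<eta>. topspace W - CB W \<eta>) ` I"
      by (metis finite_subset_image)
    with \<F>(3) C(2) have "I \<noteq> {}" by auto
    \<comment> \<open>The filtration decreases, so the finite subcover is dominated by its largest
      index, and \<open>C\<close> would already be missed there.\<close>
    with I have "Max I < \<zeta>" by auto
    moreover have "C \<inter> CB W (Max I) = {}"
    proof -
      have "CB W (Max I) \<subseteq> CB W \<eta>" if "\<eta> \<in> I" for \<eta>
        using that I(1) by (intro CB_antimono) simp
      with \<F>(3) I(3) show ?thesis by blast
    qed
    ultimately show False using below by blast
  qed
  then obtain \<mu> where "\<zeta> = osucc \<mu>" by blast
  with \<zeta> below[of \<mu>] less_osucc[of \<mu>] \<open>\<zeta> \<le> \<xi>\<close> show thesis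
    using that[of \<mu>] by (auto dest: less_le_trans)
qed

lemma CB_layer_ex:
  assumes "x \<in> topspace W" "x \<notin> CB W \<xi>"
  obtains \<mu> where "\<mu> < \<xi>" "x \<in> CB_layer W \<mu>"
  using first_missed_CB[of "{x}" \<xi>] assms by (auto simp: CB_layer_def)

text \<open>The intersection is compact, and none of its points is an accumulation point of
  it.\<close>

lemma finite_Int_CB:
  assumes "compactin W C" "C \<inter> CB W (osucc \<mu>) = {}"
  shows "finite (C \<inter> CB W \<mu>)"
proof -
  have "compactin W (C \<inter> CB W \<mu>)"
    using assms(1) CB_closed by (rule compact_Int_closedin)
  moreover have "W derived_set_of (C \<inter> CB W \<mu>) \<subseteq> CB W (osucc \<mu>)"
    unfolding CB_osucc by (rule derived_set_of_mono) simp
  then have "(C \<inter> CB W \<mu>) \<inter> W derived_set_of (C \<inter> CB W \<mu>) = {}"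
    using assms(2) by blast
  ultimately show ?thesis
    using Hausdorff_space_discrete_compactin[OF Hausdorff] by blast
qed

text \<open>A point of the layer is not in the derived set of \<open>CB W \<mu>\<close>, so it is
  isolated there; compact open sets form a base.\<close>

lemma isolating_compact_open:
  assumes "x \<in> CB_layer W \<mu>" "openin W U" "x \<in> U"
  obtains A where "A \<in> compact_open_sets W" "x \<in> A" "A \<subseteq> U" "A \<inter> CB W \<mu> = {x}"
proof -
  have "x \<in> topspace W" "x \<in> CB W \<mu>" "x \<notin> W derived_set_of CB W \<mu>"
    using assms(1) CB_layer_subset_topspace by (auto simp: CB_layer_def CB_osucc)
  then obtain T where T: "x \<in> T" "openin W T" "\<And>y. y \<in> CB W \<mu> \<Longrightarrow> y \<in> T \<Longrightarrow> y = x"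
    unfolding derived_set_of_def by blast
  have "openin W (U \<inter> T)" "x \<in> U \<inter> T" using assms T by auto
  then obtain A where "A \<in> compact_open_sets W" "x \<in> A" "A \<subseteq> U \<inter> T"
    by (rule compact_open_nbhd)
  with T(3) \<open>x \<in> CB W \<mu>\<close> show thesis by (intro that[of A]) auto
qed

text \<open>Suppose a point of \<open>U \<inter> CB W \<eta>\<close> were lost before stage
  \<open>\<xi>\<close>, say in layer \<open>\<mu>\<close>. It would be isolated in
  \<open>CB W \<mu>\<close>, which by induction agrees with \<open>CB W \<eta>\<close> on
  \<open>U\<close>; but the hypothesis makes it an accumulation point of
  \<open>CB W \<eta>\<close>.\<close>

lemma CB_locally_stationary:
  assumes "openin W U" "U \<inter> CB W \<eta> = U \<inter> CB W (osucc \<eta>)"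
  shows "\<eta> \<le> \<xi> \<Longrightarrow> U \<inter> CB W \<xi> = U \<inter> CB W \<eta>"
proof (induction \<xi> rule: less_induct)
  case (less \<xi>)
  have "x \<in> CB W \<xi>" if x: "x \<in> U" "x \<in> CB W \<eta>" for x
  proof (rule ccontr)
    assume "x \<notin> CB W \<xi>"
    moreover have "x \<in> topspace W" using x(2) CB_subset_topspace by blast
    ultimately obtain \<mu> where \<mu>: "\<mu> < \<xi>" "x \<in> CB_layer W \<mu>"
      using CB_layer_ex by blast
    then have "\<eta> \<le> \<mu>" using x(2) CB_layer_less by blast
    obtain A where A: "A \<in> compact_open_sets W" "x \<in> A" "A \<subseteq> U" "A \<inter> CB W \<mu> = {x}"
      using isolating_compact_open[OF \<mu>(2) assms(1) x(1)] by blast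
    have "U \<inter> CB W \<mu> = U \<inter> CB W \<eta>" using less.IH[OF \<mu>(1) \<open>\<eta> \<le> \<mu>\<close>] .
    with A(3,4) have "A \<inter> CB W \<eta> = {x}" by blast
    moreover have "x \<in> W derived_set_of CB W \<eta>"
      using x assms(2) by (auto simp: CB_osucc)
    then obtain y where "y \<noteq> x" "y \<in> CB W \<eta>" "y \<in> A"
      using A(1,2) unfolding derived_set_of_def compact_open_sets_def by blast
    ultimately show False by blast
  qed
  then show ?case using CB_antimono[OF less.prems] by blast
qed

end

section \<open>Scattered spaces: density of the layers and types of compact sets\<close>

locale scattered_omega_Stone = omega_Stone +
  assumes scattered: "scattered W"
begin

lemma CB_rank_empty: "CB W (CB_rank W) = {}"
  using scattered by (simp add: scattered_def CB_kernel_def)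

lemma CB_nonempty_iff: "CB W \<xi> \<noteq> {} \<longleftrightarrow> \<xi> < CB_rank W"
proof
  assume "CB W \<xi> \<noteq> {}"
  then show "\<xi> < CB_rank W" using CB_antimono[of "CB_rank W" \<xi>] CB_rank_empty by force
next
  assume "\<xi> < CB_rank W"
  then have "CB W \<xi> \<noteq> CB W (osucc \<xi>)"
    using not_less_Least unfolding CB_rank_def by blast
  then show "CB W \<xi> \<noteq> {}" using CB_osucc_subset by blast
qed

lemma CB_layer_nonempty: "\<xi> < CB_rank W \<Longrightarrow> CB_layer W \<xi> \<noteq> {}"
  using not_less_Least[of \<xi> "\<lambda>\<xi>. CB W \<xi> = CB W (osucc \<xi>)"] CB_osucc_subset
  unfolding CB_rank_def CB_layer_def by blast

lemma CB_layer_ex_rank: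
  assumes "x \<in> topspace W"
  shows "\<exists>\<mu>\<in>P_of W. x \<in> CB_layer W \<mu>"
proof -
  have "x \<notin> CB W (CB_rank W)" by (simp add: CB_rank_empty)
  with assms obtain \<mu> where "\<mu> < CB_rank W" "x \<in> CB_layer W \<mu>"
    by (rule CB_layer_ex)
  then show ?thesis by (auto simp: P_of_def N_carrier_def)
qed

text \<open>If \<open>U\<close> missed the layer, the filtration would be stationary on
  \<open>U\<close> from \<open>\<eta>\<close> on, so \<open>U \<inter> CB W \<eta>\<close> would
  equal its trace at \<open>CB_rank W\<close>, which is empty.\<close>

lemma CB_layer_dense:
  assumes "x \<in> CB W \<eta>" "openin W U" "x \<in> U"
  shows "U \<inter> CB_layer W \<eta> \<noteq> {}"
proof
  assume "U \<inter> CB_layer W \<eta> = {}"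
  then have "U \<inter> CB W \<eta> = U \<inter> CB W (osucc \<eta>)"
    using CB_osucc_subset by (auto simp: CB_layer_def)
  from CB_locally_stationary[OF assms(2) this, of "CB_rank W"] assms CB_rank_empty
  show False using CB_nonempty_iff[of \<eta>] by force
qed

lemma closure_of_CB_layer: "W closure_of CB_layer W \<eta> = CB W \<eta>"
proof
  show "W closure_of CB_layer W \<eta> \<subseteq> CB W \<eta>"
    by (rule closure_of_minimal) (auto simp: CB_layer_def CB_closed)
  show "CB W \<eta> \<subseteq> W closure_of CB_layer W \<eta>"
    using CB_layer_dense CB_subset_topspace by (fastforce simp: in_closure_of)
qed

text \<open>Points of \<open>CB W (osucc \<eta>)\<close> are outside the layer, so the layer points
  that density provides near them are different from them.\<close>

lemma derived_set_of_CB_layer: "W derived_set_of CB_layer W \<eta> = CB W (osucc \<eta>)"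
proof
  show "W derived_set_of CB_layer W \<eta> \<subseteq> CB W (osucc \<eta>)"
    unfolding CB_osucc by (rule derived_set_of_mono) (auto simp: CB_layer_def)
  show "CB W (osucc \<eta>) \<subseteq> W derived_set_of CB_layer W \<eta>"
  proof
    fix x assume x: "x \<in> CB W (osucc \<eta>)"
    then have "x \<in> CB W \<eta>" "x \<notin> CB_layer W \<eta>"
      using CB_osucc_subset by (auto simp: CB_layer_def)
    have "\<exists>y. y \<noteq> x \<and> y \<in> CB_layer W \<eta> \<and> y \<in> T" if "x \<in> T \<and> openin W T" for T
    proof -
      have "T \<inter> CB_layer W \<eta> \<noteq> {}"
        using CB_layer_dense[OF \<open>x \<in> CB W \<eta>\<close>] that by simp
      with \<open>x \<notin> CB_layer W \<eta>\<close> show ?thesis by auto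
    qed
    then show "x \<in> W derived_set_of CB_layer W \<eta>"
      using \<open>x \<in> CB W \<eta>\<close> CB_subset_topspace by (auto simp: derived_set_of_def)
  qed
qed

text \<open>In a Hausdorff space every neighbourhood of an accumulation point contains infinitely
  many points of the set. This supplies any required number of points of lower rank.\<close>

lemma infinite_CB_layer:
  assumes "\<eta> < \<xi>" "openin W U" "U \<inter> CB W \<xi> \<noteq> {}"
  shows "infinite (U \<inter> CB_layer W \<eta>)"
proof -
  obtain x where x: "x \<in> U" "x \<in> CB W \<xi>" using assms(3) by blast
  then have "x \<in> W derived_set_of CB_layer W \<eta>"
    using CB_antimono[of "osucc \<eta>" \<xi>] assms(1) by (auto simp: derived_set_of_CB_layer osucc_le_iff)
  with x(1) assms(2) show ?thesis
    unfolding derived_set_of_infinite_openin[OF Hausdorff] by (simp add: Int_commute)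
qed

text \<open>The existence of the type: the kernel is empty, so \<open>C\<close> has a last index at
  which it meets the filtration, and it does so in finitely many points.\<close>

lemma compact_open_CB_type:
  assumes "compactin W C" "C \<noteq> {}"
  obtains \<mu> where "C \<inter> CB W (osucc \<mu>) = {}" "card (C \<inter> CB W \<mu>) > 0"
proof -
  have "C \<inter> CB W (CB_rank W) = {}" by (simp add: CB_rank_empty)
  then obtain \<mu> where "\<mu> < CB_rank W" "C \<inter> CB W \<mu> \<noteq> {}" "C \<inter> CB W (osucc \<mu>) = {}"
    by (rule first_missed_CB[OF assms])
  with finite_Int_CB[OF assms(1) this(3)] show thesis
    using that by (simp add: card_gt_0_iff)
qed

text \<open>Meeting \<open>CB W (osucc \<mu>)\<close> would force infinitely many points in layer
  \<open>\<mu>\<close>, and then \<open>card\<close> would be \<open>0\<close>.\<close>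

lemma card_pos_imp_layer:
  assumes "C \<in> compact_open_sets W" "card (C \<inter> CB W \<mu>) > 0"
  shows "C \<inter> CB W \<mu> \<subseteq> CB_layer W \<mu>"
proof -
  have "finite (C \<inter> CB W \<mu>)" using assms(2) by (rule card_ge_0_finite)
  then have "finite (C \<inter> CB_layer W \<mu>)"
    by (rule finite_subset[rotated]) (auto simp: CB_layer_def)
  then have "C \<inter> CB W (osucc \<mu>) = {}"
    using infinite_CB_layer[OF less_osucc, of C \<mu>] assms(1) by (auto simp: compact_open_sets_def)
  then show ?thesis by (auto simp: CB_layer_def)
qed

text \<open>The union of isolating neighbourhoods of the points of \<open>F\<close>. It realises a
  prescribed type inside \<open>D\<close>.\<close>

lemma compact_open_with_CB_points:
  assumes D: "D \<in> compact_open_sets W" and F: "finite F" "F \<subseteq> D \<inter> CB_layer W \<mu>"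
  obtains G where "G \<in> compact_open_sets W" "G \<subseteq> D" "G \<inter> CB W \<mu> = F"
proof -
  have "\<exists>G \<in> compact_open_sets W. G \<subseteq> D \<and> G \<inter> CB W \<mu> = F"
    using F
  proof (induction F)
    case empty
    then show ?case using compact_open_empty by blast
  next
    case (insert x F)
    then obtain G where G: "G \<in> compact_open_sets W" "G \<subseteq> D" "G \<inter> CB W \<mu> = F" by blast
    have "openin W D" using D by (simp add: compact_open_sets_def)
    then obtain A where "A \<in> compact_open_sets W" "x \<in> A" "A \<subseteq> D" "A \<inter> CB W \<mu> = {x}"
      using isolating_compact_open[of x \<mu> D] insert.prems by blast
    with G compact_open_Un show ?case by (intro bexI[of _ "A \<union> G"]) auto
  qed
  then show thesis using that by blast
qed

end

section \<open>Primitivity\<close>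

text \<open>
  As \<open>card\<close> is \<open>0\<close> for infinite sets, a positive cardinality at \<open>\<mu>\<close> forces \<open>\<mu>\<close> to be the largest
  index with \<open>C \<inter> CB W \<mu>\<close> nonempty.
\<close>

definition same_CB_type :: "'a topology \<Rightarrow> 'a set \<Rightarrow> 'a set \<Rightarrow> bool" where
  "same_CB_type W C D \<longleftrightarrow> C \<in> compact_open_sets W \<and> D \<in> compact_open_sets W \<and>
    (C = {} \<and> D = {} \<or>
      (\<exists>\<mu>. card (C \<inter> CB W \<mu>) > 0 \<and> card (D \<inter> CB W \<mu>) = card (C \<inter> CB W \<mu>)))"

context scattered_omega_Stone
begin

lemma same_CB_type_sym: "same_CB_type W C D \<Longrightarrow> same_CB_type W D C"
  unfolding same_CB_type_def by metis

text \<open>The top index \<open>\<nu>\<close> of a nonempty \<open>C\<close> is below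
  \<open>\<mu>\<close>, and \<open>D\<close> has infinitely many points of rank \<open>\<nu>\<close>
  because it meets \<open>CB W \<mu>\<close>. Enough of them are enclosed in \<open>D'\<close>,
  which avoids \<open>CB W \<mu>\<close>, so that removing \<open>D'\<close> from \<open>D\<close>
  preserves the type of \<open>D\<close>.\<close>

lemma same_CB_type_disjoint_points:
  assumes C: "C \<in> compact_open_sets W" and D: "D \<in> compact_open_sets W" "card (D \<inter> CB W \<mu>) > 0"
    and C\<mu>: "C \<inter> CB W \<mu> = {}"
  obtains D' where "D' \<in> compact_open_sets W" "D' \<subseteq> D" "D' \<inter> CB W \<mu> = {}" "same_CB_type W C D'"
proof (cases "C = {}")
  case True
  then show thesis
    using that[of "{}"] compact_open_empty by (simp add: same_CB_type_def)
next
  case False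
  then obtain \<nu> where \<nu>: "C \<inter> CB W (osucc \<nu>) = {}" "card (C \<inter> CB W \<nu>) > 0"
    using compact_open_CB_type[of C] C unfolding compact_open_sets_def by blast
  have "C \<inter> CB W \<nu> \<noteq> {}" using \<nu>(2) by auto
  then have "\<nu> < \<mu>" using CB_antimono[of \<mu> \<nu>] C\<mu> by (meson disjoint_iff linorder_not_le subset_iff)
  moreover have "openin W D" "D \<inter> CB W \<mu> \<noteq> {}" using D by (auto simp: compact_open_sets_def)
  ultimately have "infinite (D \<inter> CB_layer W \<nu>)" using infinite_CB_layer by blast
  then obtain F where F: "finite F" "card F = card (C \<inter> CB W \<nu>)" "F \<subseteq> D \<inter> CB_layer W \<nu>"
    using infinite_arbitrarily_large by blast
  then obtain D' where D': "D' \<in> compact_open_sets W" "D' \<subseteq> D" "D' \<inter> CB W \<nu> = F"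
    using compact_open_with_CB_points[OF D(1)] by blast
  have "D' \<inter> CB W \<mu> \<subseteq> F \<inter> CB W \<mu>"
    using D'(3) CB_antimono[OF less_imp_le[OF \<open>\<nu> < \<mu>\<close>]] by auto
  also have "\<dots> = {}"
    using F(3) CB_layer_less[of _ \<nu> \<mu>] \<open>\<nu> < \<mu>\<close> by auto
  finally have "D' \<inter> CB W \<mu> = {}" by blast
  moreover have "same_CB_type W C D'"
    using C D' F(2) \<nu>(2) by (auto simp: same_CB_type_def)
  ultimately show thesis using that D' by blast
qed

text \<open>The cases ask which of \<open>C'\<close> and \<open>C - C'\<close> contain top points of
  \<open>C\<close>. A part without top points is copied by
  \<open>same_CB_type_disjoint_points\<close>, and its complement keeps the type of the whole. If
  both parts have some, the top points of \<open>D\<close> are distributed in the same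
  numbers.\<close>

lemma same_CB_type_split:
  assumes CD: "same_CB_type W C D" and C': "C' \<in> compact_open_sets W" "C' \<subseteq> C"
  shows "\<exists>D'\<in>compact_open_sets W. D' \<subseteq> D \<and> same_CB_type W C' D' \<and> same_CB_type W (C - C') (D - D')"
proof (cases "C = {}")
  case True
  then show ?thesis
    using CD C' compact_open_empty by (intro bexI[of _ "{}"]) (auto simp: same_CB_type_def)
next
  case False
  have C: "C \<in> compact_open_sets W" and D: "D \<in> compact_open_sets W"
    using CD by (auto simp: same_CB_type_def)
  have C'': "C - C' \<in> compact_open_sets W" using C C'(1) by (rule compact_open_Diff)
  obtain \<mu> where \<mu>: "card (C \<inter> CB W \<mu>) > 0" "card (D \<inter> CB W \<mu>) = card (C \<inter> CB W \<mu>)"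
    using CD False by (auto simp: same_CB_type_def)
  then have fin: "finite (C \<inter> CB W \<mu>)" "finite (D \<inter> CB W \<mu>)" and D\<mu>: "card (D \<inter> CB W \<mu>) > 0"
    by (auto intro: card_ge_0_finite)
  have fin': "finite (C' \<inter> CB W \<mu>)" "finite ((C - C') \<inter> CB W \<mu>)"
    by (rule finite_subset[OF _ fin(1)]; use C'(2) in blast)+
  have sum: "card (C' \<inter> CB W \<mu>) + card ((C - C') \<inter> CB W \<mu>) = card (C \<inter> CB W \<mu>)"
  proof -
    have "C \<inter> CB W \<mu> = (C' \<inter> CB W \<mu>) \<union> ((C - C') \<inter> CB W \<mu>)" using C'(2) by blast
    moreover have "card ((C' \<inter> CB W \<mu>) \<union> ((C - C') \<inter> CB W \<mu>)) =
        card (C' \<inter> CB W \<mu>) + card ((C - C') \<inter> CB W \<mu>)"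
      using fin' by (intro card_Un_disjoint) auto
    ultimately show ?thesis by simp
  qed
  consider "C' \<inter> CB W \<mu> = {}" | "(C - C') \<inter> CB W \<mu> = {}"
    | "card (C' \<inter> CB W \<mu>) > 0" "card ((C - C') \<inter> CB W \<mu>) > 0"
    using fin' by (auto simp: card_gt_0_iff)
  then show ?thesis
  proof cases
    case 1
    then obtain D' where D': "D' \<in> compact_open_sets W" "D' \<subseteq> D" "D' \<inter> CB W \<mu> = {}"
        "same_CB_type W C' D'"
      using same_CB_type_disjoint_points[OF C'(1) D D\<mu>] by blast
    then have "(D - D') \<inter> CB W \<mu> = D \<inter> CB W \<mu>" "(C - C') \<inter> CB W \<mu> = C \<inter> CB W \<mu>"
      using 1 by auto
    then have "same_CB_type W (C - C') (D - D')"
      unfolding same_CB_type_def using \<mu> C'' compact_open_Diff[OF D D'(1)] by metis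
    with D' show ?thesis by blast
  next
    case 2
    then obtain D' where D': "D' \<in> compact_open_sets W" "D' \<subseteq> D" "D' \<inter> CB W \<mu> = {}"
        "same_CB_type W (C - C') D'"
      using same_CB_type_disjoint_points[OF C'' D D\<mu>] by blast
    then have "(D - D') \<inter> CB W \<mu> = D \<inter> CB W \<mu>" "C' \<inter> CB W \<mu> = C \<inter> CB W \<mu>"
      using 2 C'(2) by auto
    then have "same_CB_type W C' (D - D')"
      unfolding same_CB_type_def using \<mu> C'(1) compact_open_Diff[OF D D'(1)] by metis
    \<comment> \<open>Here \<open>D'\<close> copies \<open>C - C'\<close>, so the witness for
      \<open>C'\<close> is its complement \<open>D - D'\<close>.\<close>
    moreover have "D - (D - D') = D'" using D'(2) by blast
    ultimately show ?thesis using D' compact_open_Diff[OF D D'(1)]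
      by (intro bexI[of _ "D - D'"]) auto
  next
    case 3
    have "card (C' \<inter> CB W \<mu>) \<le> card (D \<inter> CB W \<mu>)" using sum \<mu>(2) by simp
    then obtain F where F: "F \<subseteq> D \<inter> CB W \<mu>" "card F = card (C' \<inter> CB W \<mu>)" "finite F"
      using obtain_subset_with_card_n by metis
    then have "F \<subseteq> D \<inter> CB_layer W \<mu>"
      using card_pos_imp_layer[OF D D\<mu>] by blast
    then obtain D' where D': "D' \<in> compact_open_sets W" "D' \<subseteq> D" "D' \<inter> CB W \<mu> = F"
      using compact_open_with_CB_points[OF D F(3)] by blast
    have "(D - D') \<inter> CB W \<mu> = D \<inter> CB W \<mu> - F" using D'(3) by blast
    then have "card ((D - D') \<inter> CB W \<mu>) = card (D \<inter> CB W \<mu>) - card F"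
      using F by (simp add: card_Diff_subset)
    then have "card ((D - D') \<inter> CB W \<mu>) = card ((C - C') \<inter> CB W \<mu>)"
      using sum \<mu>(2) F(2) by simp
    then have "same_CB_type W (C - C') (D - D')"
      unfolding same_CB_type_def using 3(2) C'' compact_open_Diff[OF D D'(1)] by metis
    moreover have "same_CB_type W C' D'"
      unfolding same_CB_type_def using 3(1) C'(1) D' F(2) by metis
    ultimately show ?thesis using D' by blast
  qed
qed

lemma same_CB_type_iso:
  assumes "same_CB_type W C D"
  shows "below (compact_open_sets W) C \<simeq> below (compact_open_sets W) D"
proof (rule below_iso_if_back_and_forth[where E = "same_CB_type W"])
  show "countable {A \<in> compact_open_sets W. A \<subseteq> C}" "countable {A \<in> compact_open_sets W. A \<subseteq> D}"
    using assms by (auto simp: same_CB_type_def intro: countable_compact_open_below)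
  show "A \<in> compact_open_sets W" "A = {} \<Longrightarrow> B = {}" if "same_CB_type W A B" for A B
    using that by (auto simp: same_CB_type_def)
qed (fact assms compact_open_empty compact_open_Un compact_open_Int compact_open_Diff
      same_CB_type_sym same_CB_type_split)+

lemma pseudo_indecomposable_single_point:
  assumes C: "C \<in> compact_open_sets W" and card: "card (C \<inter> CB W \<mu>) = 1"
  shows "pseudo_indecomposable (compact_open_sets W) C"
  unfolding pseudo_indecomposable_def
proof (intro ballI impI)
  fix B assume B: "B \<in> compact_open_sets W" "B \<subseteq> C"
  obtain x where x: "C \<inter> CB W \<mu> = {x}" using card by (rule card_1_singletonE)
  then have "B \<inter> CB W \<mu> = {x} \<or> (C - B) \<inter> CB W \<mu> = {x}" using B(2) by blast
  moreover have "same_CB_type W D C" if "D \<in> compact_open_sets W" "D \<inter> CB W \<mu> = {x}" for D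
    unfolding same_CB_type_def using that C x by (intro conjI disjI2 exI[of _ \<mu>]) simp_all
  ultimately have "same_CB_type W B C \<or> same_CB_type W (C - B) C"
    using B(1) compact_open_Diff[OF C B(1)] by blast
  then show "below (compact_open_sets W) B \<simeq> below (compact_open_sets W) C \<or>
      below (compact_open_sets W) (C - B) \<simeq> below (compact_open_sets W) C"
    using same_CB_type_iso by blast
qed

text \<open>Induction splits off a compact open \<open>G\<close> with exactly one top point.
  Counting by \<open>Suc n\<close> makes the base case a set with a single top point.\<close>

lemma compact_open_decomposition:
  assumes "C \<in> compact_open_sets W" "card (C \<inter> CB W \<mu>) = Suc n"
  shows "\<exists>\<F>. finite \<F> \<and>
    \<F> \<subseteq> {B \<in> compact_open_sets W. pseudo_indecomposable (compact_open_sets W) B} \<and>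
    disjoint \<F> \<and> C = \<Union>\<F>"
  using assms
proof (induction n arbitrary: C)
  case 0
  then show ?case
    using pseudo_indecomposable_single_point[of C \<mu>]
    by (intro exI[of _ "{C}"]) (auto simp: disjoint_def)
next
  case (Suc n)
  have pos: "card (C \<inter> CB W \<mu>) > 0" using Suc.prems by simp
  then have "C \<inter> CB W \<mu> \<noteq> {}" by auto
  then obtain x where x: "x \<in> C \<inter> CB W \<mu>" by blast
  then have "{x} \<subseteq> C \<inter> CB_layer W \<mu>"
    using card_pos_imp_layer[OF Suc.prems(1) pos] by blast
  then obtain G where G: "G \<in> compact_open_sets W" "G \<subseteq> C" "G \<inter> CB W \<mu> = {x}"
    by (rule compact_open_with_CB_points[OF Suc.prems(1), rotated]) simp_all
  have "(C - G) \<inter> CB W \<mu> = (C \<inter> CB W \<mu>) - {x}" using G(3) by blast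
  then have "card ((C - G) \<inter> CB W \<mu>) = Suc n"
    using Suc.prems(2) x by (simp add: card_Diff_singleton)
  from Suc.IH[OF compact_open_Diff[OF Suc.prems(1) G(1)] this]
  obtain \<F> where \<F>: "finite \<F>"
      "\<F> \<subseteq> {B \<in> compact_open_sets W. pseudo_indecomposable (compact_open_sets W) B}"
      "disjoint \<F>" "C - G = \<Union>\<F>"
    by (elim exE conjE)
  have "B \<inter> G = {}" if "B \<in> \<F>" for B using that \<F>(4) by blast
  then have "disjoint (insert G \<F>)"
    using \<F>(3) by (auto simp: disjoint_def)
  moreover have "C = \<Union>(insert G \<F>)" using \<F>(4) G(2) by auto
  moreover have "pseudo_indecomposable (compact_open_sets W) G"
    using pseudo_indecomposable_single_point[OF G(1), of \<mu>] G(3) by simp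
  ultimately show ?case
    using \<F>(1,2) G(1) by (intro exI[of _ "insert G \<F>"]) auto
qed

lemma primitive: "primitive_space W"
  unfolding primitive_space_def primitive_ring_def
proof
  fix C assume C: "C \<in> compact_open_sets W"
  show "\<exists>\<F>. finite \<F> \<and>
    \<F> \<subseteq> {B \<in> compact_open_sets W. pseudo_indecomposable (compact_open_sets W) B} \<and>
    disjoint \<F> \<and> C = \<Union>\<F>"
  proof (cases "C = {}")
    case True
    \<comment> \<open>The empty set has no type; it is the union of the empty family.\<close>
    then show ?thesis by (intro exI[of _ "{}"]) auto
  next
    case False
    then obtain \<mu> where "card (C \<inter> CB W \<mu>) > 0"
      using compact_open_CB_type[of C] C unfolding compact_open_sets_def by blast
    then show ?thesis
      using compact_open_decomposition[OF C] by (metis gr0_conv_Suc)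
  qed
qed

section \<open>The trim partition\<close>

lemma complete: "complete_partition W (P_of W) (CB_layer W)"
  unfolding complete_partition_def
  using CB_layer_subset_topspace CB_layer_ex_rank by blast

lemma P_partition: "P_partition W (P_of W) N_lt (CB_layer W)"
  unfolding P_partition_def
proof (intro conjI ballI)
  show "PO_system (P_of W) N_lt"
    by (auto simp: PO_system_def N_lt_def intro: antisymp_onI transp_onI)
  show "disjoint_family_on (CB_layer W) (P_of W)"
    unfolding disjoint_family_on_def using CB_layer_unique by blast
  fix \<xi> assume "\<xi> \<in> P_of W"
  then show "CB_layer W \<xi> \<noteq> {}" by (auto simp: P_of_def N_carrier_def dest: CB_layer_nonempty)
  show "CB_layer W \<xi> \<subseteq> topspace W" by (rule CB_layer_subset_topspace)
  \<comment> \<open>The derived set of layer \<open>\<xi>\<close> thus consists of the points of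
    larger rank, which are the smaller indices for the reversed order \<open>N_lt\<close>.\<close>
  have "x \<in> CB W (osucc \<xi>) \<longleftrightarrow> \<xi> < \<eta>" if "x \<in> CB_layer W \<eta>" for x \<eta>
    using CB_layer_less[OF that] by (simp add: osucc_le_iff)
  then show "(W derived_set_of CB_layer W \<xi>) \<inter> (\<Union>q\<in>P_of W. CB_layer W q) =
      (\<Union>q\<in>{q \<in> P_of W. N_lt q \<xi>}. CB_layer W q)"
    unfolding derived_set_of_CB_layer N_lt_def by blast
qed

text \<open>Layers of rank above \<open>\<xi>\<close> lie in \<open>CB W \<xi>\<close>, where
  \<open>A\<close> has only \<open>x\<close>, a point of rank \<open>\<xi>\<close>. Layers of rank
  at most \<open>\<xi>\<close> are met because they are dense at \<open>x\<close>.\<close>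

lemma trim_set_CB_layer:
  assumes A: "A \<in> compact_open_sets W" "A \<inter> CB W \<xi> = {x}" and x: "x \<in> CB_layer W \<xi>"
  shows "trim_set W (P_of W) N_lt (CB_layer W) \<xi> A"
proof -
  have Ax: "A \<inter> CB_layer W \<xi> = {x}" using A(2) x by (auto simp: CB_layer_def)
  have "A \<inter> CB_layer W \<eta> \<noteq> {} \<longleftrightarrow> \<eta> \<le> \<xi>" for \<eta>
  proof
    assume "A \<inter> CB_layer W \<eta> \<noteq> {}"
    then obtain y where y: "y \<in> A" "y \<in> CB_layer W \<eta>" by blast
    show "\<eta> \<le> \<xi>"
    proof (rule ccontr)
      assume "\<not> \<eta> \<le> \<xi>"
      then have "y \<in> CB W \<xi>" using CB_layer_less[OF y(2)] by simp
      with y(1) A(2) have "y = x" by blast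
      with CB_layer_unique[OF y(2)] x \<open>\<not> \<eta> \<le> \<xi>\<close> show False by auto
    qed
  next
    assume "\<eta> \<le> \<xi>"
    then have "x \<in> CB W \<eta>" using CB_layer_less[OF x] by simp
    then show "A \<inter> CB_layer W \<eta> \<noteq> {}"
      using CB_layer_dense[of x \<eta> A] A by (auto simp: compact_open_sets_def)
  qed
  then show ?thesis
    using A(1) Ax by (auto simp: trim_set_def type_of_def po_le_def N_lt_def)
qed

lemma trim: "trim_partition W (P_of W) N_lt (CB_layer W)"
proof -
  let ?trim = "trim_set W (P_of W) N_lt (CB_layer W)"
  \<comment> \<open>These open trim sets give both the neighbourhood bases and the trim
    neighbourhoods of points of each layer.\<close>
  have nbhd: "\<exists>A. ?trim \<xi> A \<and> openin W A \<and> x \<in> A \<and> A \<subseteq> U"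
    if "x \<in> CB_layer W \<xi>" "openin W U" "x \<in> U" for \<xi> x U
  proof -
    obtain A where A: "A \<in> compact_open_sets W" "x \<in> A" "A \<subseteq> U" "A \<inter> CB W \<xi> = {x}"
      using isolating_compact_open \<open>x \<in> CB_layer W \<xi>\<close> \<open>openin W U\<close> \<open>x \<in> U\<close> by blast
    with trim_set_CB_layer[OF this(1,4)] that(1) show ?thesis
      by (auto simp: compact_open_sets_def)
  qed
  show ?thesis
    unfolding trim_partition_def
  proof (intro conjI ballI impI)
    show "P_partition W (P_of W) N_lt (CB_layer W)" by (rule P_partition)
  next
    fix x assume "x \<in> topspace W"
    then obtain \<xi> where \<xi>: "\<xi> \<in> P_of W" "x \<in> CB_layer W \<xi>"
      using CB_layer_ex_rank by blast
    show "neighbourhood_base_at x (\<lambda>A. \<exists>p\<in>P_of W. ?trim p A) W"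
      unfolding neighbourhood_base_at_def
    proof (intro allI impI)
      fix U assume "openin W U \<and> x \<in> U"
      then obtain A where "?trim \<xi> A" "openin W A" "x \<in> A" "A \<subseteq> U"
        using nbhd[OF \<xi>(2)] by blast
      with \<xi>(1) show "\<exists>B A. openin W B \<and> (\<exists>p\<in>P_of W. ?trim p A) \<and> x \<in> B \<and> B \<subseteq> A \<and> A \<subseteq> U"
        by (intro exI[of _ A] conjI bexI[of _ \<xi>]) auto
    qed
  next
    fix \<xi> x assume \<xi>: "\<xi> \<in> P_of W" and x: "x \<in> topspace W" and base: "neighbourhood_base_at x (?trim \<xi>) W"
    obtain \<eta> where \<eta>: "\<eta> \<in> P_of W" "x \<in> CB_layer W \<eta>"
      using CB_layer_ex_rank[OF x] by blast
    \<comment> \<open>Comparing a \<open>\<xi>\<close>-trim \<open>A\<close> around \<open>x\<close>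
      with an \<open>\<eta>\<close>-trim \<open>B\<close> containing it: \<open>A\<close> meets
      layer \<open>\<eta>\<close> at \<open>x\<close>, and \<open>B\<close> meets layer
      \<open>\<xi>\<close> because \<open>A\<close> does. The two types give opposite
      inequalities.\<close>
    obtain B where B: "?trim \<eta> B" "openin W B" "x \<in> B"
      using nbhd[OF \<eta>(2) openin_topspace x] by blast
    then obtain A where A: "?trim \<xi> A" "x \<in> A" "A \<subseteq> B"
      using base unfolding neighbourhood_base_at_def by blast
    have "\<eta> \<in> type_of (P_of W) (CB_layer W) A"
      using \<eta> A(2) by (auto simp: type_of_def)
    then have "\<eta> \<le> \<xi>" using A(1) by (auto simp: trim_set_def po_le_def N_lt_def)
    have "\<xi> \<in> type_of (P_of W) (CB_layer W) A"
      using A(1) \<xi> by (auto simp: trim_set_def po_le_def)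
    then have "\<xi> \<in> type_of (P_of W) (CB_layer W) B"
      using A(3) by (auto simp: type_of_def)
    then have "\<xi> \<le> \<eta>" using B(1) by (auto simp: trim_set_def po_le_def N_lt_def)
    with \<open>\<eta> \<le> \<xi>\<close> \<eta>(2) show "x \<in> CB_layer W \<xi>" by simp
  next
    fix \<xi> x assume "x \<in> CB_layer W \<xi>"
    then show "\<exists>A. ?trim \<xi> A \<and> x \<in> A"
      using nbhd[of x \<xi> "topspace W"] CB_layer_subset_topspace by blast
  qed
qed

text \<open>The closures are the sets \<open>CB W \<xi>\<close>, which are closed and decreasing, so
  compactness persists after it first occurs.\<close>

lemma compactin_closure_CB_layer_iff:
  "compactin W (W closure_of CB_layer W \<xi>) \<longleftrightarrow> CB_compact_rank W \<le> \<xi>"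
proof
  show "CB_compact_rank W \<le> \<xi>" if "compactin W (W closure_of CB_layer W \<xi>)"
    unfolding CB_compact_rank_def using that by (rule Least_le)
  assume "CB_compact_rank W \<le> \<xi>"
  then show "compactin W (W closure_of CB_layer W \<xi>)"
    using compactin_closure_CB_compact_rank[OF Hausdorff] CB_antimono CB_closed
    unfolding closure_of_CB_layer by (blast intro: closed_compactin)
qed

lemma CB_compact_rank_le: "CB_compact_rank W \<le> CB_rank W"
  using compactin_closure_CB_layer_iff[of "CB_rank W"]
  by (simp add: closure_of_CB_layer CB_rank_empty)

text \<open>The compact nonempty set \<open>CB W (CB_compact_rank W)\<close> has a type with top
  index \<open>\<mu>\<close>. It contains all later terms of the filtration, so
  \<open>CB W \<mu>\<close> itself is finite and nonempty and the next term is empty.\<close>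

lemma CB_rank_eq_osucc:
  assumes "CB_compact_rank W < CB_rank W"
  obtains \<mu> where "CB_rank W = osucc \<mu>" "CB_compact_rank W \<le> \<mu>" "finite (CB W \<mu>)"
proof -
  let ?C = "CB W (CB_compact_rank W)"
  have C: "compactin W ?C" "?C \<noteq> {}"
    using compactin_closure_CB_compact_rank[OF Hausdorff] assms
    by (simp_all add: closure_of_CB_layer CB_nonempty_iff)
  then obtain \<mu> where \<mu>: "?C \<inter> CB W (osucc \<mu>) = {}" "card (?C \<inter> CB W \<mu>) > 0"
    by (rule compact_open_CB_type)
  have le: "CB_compact_rank W \<le> \<mu>"
  proof (rule ccontr)
    assume "\<not> CB_compact_rank W \<le> \<mu>"
    then have "osucc \<mu> \<le> CB_compact_rank W" by (simp add: osucc_le_iff)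
    then show False using CB_antimono \<mu>(1) C(2) by blast
  qed
  then have "?C \<inter> CB W \<mu> = CB W \<mu>" "?C \<inter> CB W (osucc \<mu>) = CB W (osucc \<mu>)"
    using CB_antimono CB_osucc_subset by blast+
  with \<mu> have "CB W (osucc \<mu>) = {}" "CB W \<mu> \<noteq> {}" "finite (CB W \<mu>)"
    by (auto intro: card_ge_0_finite)
  moreover from this have "CB_rank W = osucc \<mu>"
    using CB_nonempty_iff[of \<mu>] CB_nonempty_iff[of "osucc \<mu>"] osucc_le_iff[of \<mu> "CB_rank W"]
    by (metis antisym not_le)
  ultimately show thesis using that le by blast
qed

lemma trim_PLf: "trim_PLf_partition W (P_of W) N_lt (L_of W) (f_of W) (CB_layer W)"
proof (cases "CB_compact_rank W = CB_rank W")
  case True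
  \<comment> \<open>No index below \<open>CB_rank W\<close> reaches
    \<open>CB_compact_rank W\<close>, so the empty function has the required domain.\<close>
  then have "L_of W = {}" by (auto simp: L_of_def P_of_def N_carrier_def)
  moreover have "f_of W = Map.empty" using True by (simp add: f_of_def)
  moreover have "compactin W (W closure_of CB_layer W \<xi>) \<longleftrightarrow> \<xi> \<in> L_of W" if "\<xi> \<in> P_of W" for \<xi>
    using that by (auto simp: compactin_closure_CB_layer_iff L_of_def)
  ultimately show ?thesis
    by (auto simp: trim_PLf_partition_def trim lower_subset_def po_minimal_def)
next
  case False
  then obtain \<mu> where \<mu>: "CB_rank W = osucc \<mu>" "CB_compact_rank W \<le> \<mu>" "finite (CB W \<mu>)"
    using CB_rank_eq_osucc CB_compact_rank_le by (metis le_less)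
  have P: "\<xi> \<in> P_of W \<longleftrightarrow> \<xi> \<le> \<mu>" for \<xi>
    using osucc_le_iff[of \<mu> \<xi>] by (auto simp: P_of_def N_carrier_def \<mu>(1) not_le[symmetric])
  have L: "L_of W = {\<xi>. CB_compact_rank W \<le> \<xi> \<and> \<xi> \<le> \<mu>}"
    by (auto simp: L_of_def P)
  have layer: "CB_layer W \<mu> = CB W \<mu>"
    using CB_rank_empty by (simp add: CB_layer_def \<mu>(1))
  have "CB W \<mu> \<noteq> {}" by (simp add: CB_nonempty_iff \<mu>(1) less_osucc)
  then have card: "card (CB W \<mu>) > 0" using \<mu>(3) by (simp add: card_gt_0_iff)
  have "CB_number W = Some (card (CB W \<mu>))"
    using \<mu> CB_rank_empty by (simp add: CB_number_def CB_kernel_def)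
  then have f: "f_of W = [\<mu> \<mapsto> card (CB W \<mu>)]"
    using False \<mu>(1) by (auto simp: f_of_def)
  \<comment> \<open>The order is reversed, so the minimal element is the largest ordinal of
    \<open>L_of W\<close>.\<close>
  have "po_minimal (L_of W) N_lt = {\<mu>}"
    using \<mu>(2) by (force simp: po_minimal_def po_le_def N_lt_def L)
  moreover have "\<mu> \<in> po_discrete (P_of W) N_lt"
    by (simp add: po_discrete_def N_lt_def P)
  moreover have "lower_subset (P_of W) N_lt (L_of W)"
    by (auto simp: lower_subset_def po_le_def N_lt_def L P)
  moreover have "compactin W (W closure_of CB_layer W \<xi>) \<longleftrightarrow> \<xi> \<in> L_of W" if "\<xi> \<in> P_of W" for \<xi>
    using that by (auto simp: compactin_closure_CB_layer_iff L_of_def)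
  ultimately show ?thesis
    using card \<mu>(3) by (auto simp: trim_PLf_partition_def trim f layer)
qed

end

theorem theorem13:
  fixes W :: "'a topology"
  assumes "omega_Stone_space W"
    and "scattered W"
  shows "primitive_space W \<and>
    complete_partition W (P_of W) (CB_layer W) \<and>
    trim_PLf_partition W (P_of W) N_lt (L_of W) (f_of W) (CB_layer W)"
proof -
  interpret scattered_omega_Stone W
    using assms by unfold_locales
  show ?thesis using primitive complete trim_PLf by blast
qed

end
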